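(* Let $p=p^*=p^2\in A_\Theta^\infty$ be a projection which does not commute with its partial derivatives (i.e. $p$ fails to commute with at least one of $\partial_1p,\partial_2p$). Then the Gauss–Bonnet theorem does not hold for $tp$ for $t$ in some interval: there are $\epsilon\in\mathbb R$ and $\delta>0$ such that $\Omega_p(t)\ne0$ for all $t$ with $|t-\epsilon|<\delta$.
   Context: $A_\Theta$ is the noncommutative two-torus: the universal unital $C^*$-algebra generated by unitaries $U,V$ with $UV=e^{2\pi i\theta}VU$ ($\theta\in\mathbb R$); $A_\Theta^\infty=\{\sum_{m,n}a_{mn}U^mV^n:(a_{mn})\text{ rapidly decreasing}\}$; $\tau(\sum a_{mn}U^mV^n)=a_{00}$ is the canonical faithful trace; $\partial_1,\partial_2$ are the canonical derivations with $\partial_1U=2\pi iU$, $\partial_1V=0$, $\partial_2U=0$, $\partial_2V=2\pi iV$. For self-adjoint $f\in A_\Theta^\infty$ and $t\in\mathbb R$, $$\Omega_f(t):=\tfrac12\tau\Big((\partial_2e^{-tf/2})(\partial_2e^{tf})+(\partial_2e^{tf/2})(\partial_2e^{tf})e^{-tf}\Big),$$ which is the Gauss–Bonnet term $\tau(R\sqrt{\det g})$ for the metric $g=\mathrm{diag}(e^{tf},1)$, $R$ being its scalar curvature; the Gauss–Bonnet theorem for $tf$ is the statement $\Omega_f(t)=0$. *)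

theory Defs
  imports "HOL-Analysis.Analysis" "HOL-Algebra.Algebraic_Closure_Type"
begin

section \<open>Unital C*-algebras\<close>

text \<open>
  Nonzero unital C*-algebras as types. The ambient classes provide the Banach algebra structure over
  the reals (hence \<open>exp\<close>, limits and infinite sums); \<open>norm 1 = 1\<close>, demanded by
  \<open>real_normed_algebra_1\<close>, is automatic in a nonzero unital C*-algebra.
\<close>

class cstar_algebra = real_normed_algebra_1 + banach +
  fixes scaleC :: "complex \<Rightarrow> 'a \<Rightarrow> 'a"  (infixr \<open>*\<^sub>C\<close> 75)
    and star :: "'a \<Rightarrow> 'a"
  assumes scaleC_of_real: "complex_of_real r *\<^sub>C x = r *\<^sub>R x"
    and scaleC_add_right: "c *\<^sub>C (x + y) = c *\<^sub>C x + c *\<^sub>C y"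
    and scaleC_add_left: "(c + d) *\<^sub>C x = c *\<^sub>C x + d *\<^sub>C x"
    and scaleC_scaleC: "c *\<^sub>C d *\<^sub>C x = (c * d) *\<^sub>C x"
    and mult_scaleC_left: "(c *\<^sub>C x) * y = c *\<^sub>C (x * y)"
    and mult_scaleC_right: "x * (c *\<^sub>C y) = c *\<^sub>C (x * y)"
    and norm_scaleC: "norm (c *\<^sub>C x) = cmod c * norm x"
    and star_star: "star (star x) = x"
    and star_add: "star (x + y) = star x + star y"
    and star_scaleC: "star (c *\<^sub>C x) = cnj c *\<^sub>C star x"
    and star_mult: "star (x * y) = star y * star x"
    and norm_star_mult_self: "norm (star x * x) = (norm x)\<^sup>2"

text \<open>
  A universal property quantifies over all C*-algebras inside a formula, which types of a class do
  not allow. For that purpose unital C*-algebras are also given as structures with a carrier, on top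
  of the rings and modules of HOL-Algebra.
\<close>

record 'b cstar_structure = "(complex, 'b) module" +
  adj :: "'b \<Rightarrow> 'b"
  nrm :: "'b \<Rightarrow> real"

locale unital_cstar_algebra =
  Module.module "ring_of_type_algebra :: complex ring" B + ring B
  for B :: "('b, 'm) cstar_structure_scheme" (structure) +
  assumes smult_mult_left:
      "x \<in> carrier B \<Longrightarrow> y \<in> carrier B \<Longrightarrow> (c \<odot> x) \<otimes> y = c \<odot> (x \<otimes> y)"
    and smult_mult_right:
      "x \<in> carrier B \<Longrightarrow> y \<in> carrier B \<Longrightarrow> x \<otimes> (c \<odot> y) = c \<odot> (x \<otimes> y)"
    and adj_closed: "x \<in> carrier B \<Longrightarrow> adj B x \<in> carrier B"
    and adj_adj: "x \<in> carrier B \<Longrightarrow> adj B (adj B x) = x"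
    and adj_add:
      "x \<in> carrier B \<Longrightarrow> y \<in> carrier B \<Longrightarrow> adj B (x \<oplus> y) = adj B x \<oplus> adj B y"
    and adj_smult: "x \<in> carrier B \<Longrightarrow> adj B (c \<odot> x) = cnj c \<odot> adj B x"
    and adj_mult:
      "x \<in> carrier B \<Longrightarrow> y \<in> carrier B \<Longrightarrow> adj B (x \<otimes> y) = adj B y \<otimes> adj B x"
    and nrm_nonneg: "x \<in> carrier B \<Longrightarrow> 0 \<le> nrm B x"
    and nrm_eq_0_iff: "x \<in> carrier B \<Longrightarrow> nrm B x = 0 \<longleftrightarrow> x = \<zero>"
    and nrm_add: "x \<in> carrier B \<Longrightarrow> y \<in> carrier B \<Longrightarrow> nrm B (x \<oplus> y) \<le> nrm B x + nrm B y"
    and nrm_smult: "x \<in> carrier B \<Longrightarrow> nrm B (c \<odot> x) = cmod c * nrm B x"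
    and nrm_mult: "x \<in> carrier B \<Longrightarrow> y \<in> carrier B \<Longrightarrow> nrm B (x \<otimes> y) \<le> nrm B x * nrm B y"
    and nrm_adj_mult_self: "x \<in> carrier B \<Longrightarrow> nrm B (adj B x \<otimes> x) = (nrm B x)\<^sup>2"
    and complete:
      "range s \<subseteq> carrier B \<Longrightarrow>
       (\<And>e. e > 0 \<Longrightarrow> \<exists>N. \<forall>i\<ge>N. \<forall>j\<ge>N. nrm B (s i \<ominus> s j) < e) \<Longrightarrow>
       \<exists>l\<in>carrier B. (\<lambda>i. nrm B (s i \<ominus> l)) \<longlonglongrightarrow> 0"

definition cstar_of_type :: "'a::cstar_algebra cstar_structure" where
  "cstar_of_type =
    \<lparr> carrier = UNIV, monoid.mult = (*), one = 1, ring.zero = 0, add = (+),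
      smult = (*\<^sub>C), adj = star, nrm = norm \<rparr>"

lemma unital_cstar_algebra_cstar_of_type:
  "unital_cstar_algebra (cstar_of_type :: 'a::cstar_algebra cstar_structure)"
proof -
  let ?A = "cstar_of_type :: 'a cstar_structure"
  have ring: "ring ?A"
  proof (rule ringI)
    show "abelian_group ?A"
    proof (rule abelian_groupI)
      fix x assume "x \<in> carrier ?A"
      show "\<exists>y\<in>carrier ?A. y \<oplus>\<^bsub>?A\<^esub> x = \<zero>\<^bsub>?A\<^esub>"
        by (rule bexI[of _ "- x"]) (simp_all add: cstar_of_type_def)
    qed (simp_all add: cstar_of_type_def algebra_simps)
    show "Group.monoid ?A"
      by unfold_locales (simp_all add: cstar_of_type_def algebra_simps)
  qed (simp_all add: cstar_of_type_def algebra_simps)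
  have one: "1 *\<^sub>C x = x" for x :: 'a
    using scaleC_of_real[of 1 x] by simp
  have module: "Module.module (ring_of_type_algebra :: complex ring) ?A"
    using ring
    by (intro Module.moduleI cring_from_type_algebra ring.is_abelian_group)
       (simp_all add: cstar_of_type_def ring_of_type_algebra_def scaleC_add_left
          scaleC_add_right scaleC_scaleC one)
  have minus: "x \<ominus>\<^bsub>?A\<^esub> y = x - y" for x y :: 'a
  proof -
    have "\<ominus>\<^bsub>?A\<^esub> y \<oplus>\<^bsub>?A\<^esub> y = \<zero>\<^bsub>?A\<^esub>"
      using ring by (intro abelian_group.l_neg ring.is_abelian_group)
        (simp_all add: cstar_of_type_def)
    hence "\<ominus>\<^bsub>?A\<^esub> y = - y"
      by (simp add: cstar_of_type_def eq_neg_iff_add_eq_0)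
    thus ?thesis
      by (simp add: a_minus_def) (simp add: cstar_of_type_def)
  qed
  have complete: "\<exists>l\<in>carrier ?A. (\<lambda>i. nrm ?A (s i \<ominus>\<^bsub>?A\<^esub> l)) \<longlonglongrightarrow> 0"
    if "\<And>e. e > 0 \<Longrightarrow> \<exists>N. \<forall>i\<ge>N. \<forall>j\<ge>N. nrm ?A (s i \<ominus>\<^bsub>?A\<^esub> s j) < e"
    for s :: "nat \<Rightarrow> 'a"
  proof -
    have "Cauchy s"
      using that unfolding minus by (auto simp: Cauchy_def dist_norm cstar_of_type_def)
    then obtain l where "s \<longlonglongrightarrow> l"
      using Cauchy_convergent convergent_def by blast
    hence "(\<lambda>i. norm (s i - l)) \<longlonglongrightarrow> 0"
      by (simp add: LIM_zero_iff tendsto_norm_zero)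
    thus ?thesis
      unfolding minus by (auto simp: cstar_of_type_def)
  qed
  show ?thesis
    using complete
    by (intro unital_cstar_algebra.intro module ring unital_cstar_algebra_axioms.intro)
       (simp_all add: cstar_of_type_def mult_scaleC_left mult_scaleC_right star_star
          star_add star_scaleC star_mult norm_triangle_ineq norm_scaleC norm_mult_ineq
          norm_star_mult_self)
qed

definition unital_star_hom ::
    "('a, 'm) cstar_structure_scheme \<Rightarrow> ('b, 'n) cstar_structure_scheme \<Rightarrow> ('a \<Rightarrow> 'b) set" where
  "unital_star_hom A B = {\<phi> \<in> ring_hom A B.
     (\<forall>c. \<forall>x\<in>carrier A. \<phi> (c \<odot>\<^bsub>A\<^esub> x) = c \<odot>\<^bsub>B\<^esub> \<phi> x) \<and>
     (\<forall>x\<in>carrier A. \<phi> (adj A x) = adj B (\<phi> x))}"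

section \<open>The noncommutative two-torus\<close>

definition unitary_in :: "('b, 'm) cstar_structure_scheme \<Rightarrow> 'b \<Rightarrow> bool" where
  "unitary_in B u \<longleftrightarrow> u \<in> carrier B \<and> adj B u \<otimes>\<^bsub>B\<^esub> u = \<one>\<^bsub>B\<^esub> \<and> u \<otimes>\<^bsub>B\<^esub> adj B u = \<one>\<^bsub>B\<^esub>"

definition rotation_pair :: "real \<Rightarrow> ('b, 'm) cstar_structure_scheme \<Rightarrow> 'b \<Rightarrow> 'b \<Rightarrow> bool" where
  "rotation_pair \<theta> B u v \<longleftrightarrow> unitary_in B u \<and> unitary_in B v \<and>
     u \<otimes>\<^bsub>B\<^esub> v = exp (2 * of_real pi * \<i> * of_real \<theta>) \<odot>\<^bsub>B\<^esub> (v \<otimes>\<^bsub>B\<^esub> u)"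

definition closed_star_subalgebra :: "'a::cstar_algebra set \<Rightarrow> bool" where
  "closed_star_subalgebra S \<longleftrightarrow> closed S \<and> 1 \<in> S \<and>
     (\<forall>x\<in>S. \<forall>y\<in>S. x + y \<in> S \<and> x * y \<in> S) \<and>
     (\<forall>c. \<forall>x\<in>S. c *\<^sub>C x \<in> S) \<and> (\<forall>x\<in>S. star x \<in> S)"

text \<open>
  \<open>nc_torus \<theta> U V\<close>: the type \<open>'a\<close> is the universal unital C*-algebra generated by unitaries
  \<open>U\<close>, \<open>V\<close> with \<open>UV = exp(2\<pi>i\<theta>) VU\<close>.

  The algebras \<open>B\<close> of the universal property have their carrier inside the type \<open>'a\<close>. This is no
  restriction: \<open>'a\<close> is a nonzero complex vector space, so it has at least continuum many elements,
  whereas a C*-algebra generated by two elements is separable and has at most continuum many. Hence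
  every C*-algebra generated by such a pair \<open>u\<close>, \<open>v\<close> occurs here up to isomorphism, and for an
  arbitrary algebra the homomorphism takes values in the C*-subalgebra generated by \<open>u\<close>, \<open>v\<close>.
\<close>

definition nc_torus :: "real \<Rightarrow> 'a::cstar_algebra \<Rightarrow> 'a \<Rightarrow> bool" where
  "nc_torus \<theta> U V \<longleftrightarrow>
     rotation_pair \<theta> cstar_of_type U V \<and>
     (\<forall>S. closed_star_subalgebra S \<and> U \<in> S \<and> V \<in> S \<longrightarrow> S = UNIV) \<and>
     (\<forall>(B :: 'a cstar_structure) u v. unital_cstar_algebra B \<and> rotation_pair \<theta> B u v \<longrightarrow>
        (\<exists>!\<phi>. \<phi> \<in> unital_star_hom cstar_of_type B \<and> \<phi> U = u \<and> \<phi> V = v))"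

section \<open>Smooth elements, trace and derivations\<close>

text \<open>Integer powers of a unitary.\<close>

definition upow :: "'a::cstar_algebra \<Rightarrow> int \<Rightarrow> 'a" where
  "upow u m = (if m \<ge> 0 then u ^ nat m else star u ^ nat (- m))"

definition rapidly_decreasing :: "(int \<times> int \<Rightarrow> complex) \<Rightarrow> bool" where
  "rapidly_decreasing a \<longleftrightarrow>
     (\<forall>k::nat. \<exists>C. \<forall>m n. (1 + \<bar>real_of_int m\<bar> + \<bar>real_of_int n\<bar>) ^ k * cmod (a (m, n)) \<le> C)"

definition smooth_expansion ::
    "'a::cstar_algebra \<Rightarrow> 'a \<Rightarrow> (int \<times> int \<Rightarrow> complex) \<Rightarrow> 'a \<Rightarrow> bool" where
  "smooth_expansion U V a x \<longleftrightarrow> rapidly_decreasing a \<and>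
     ((\<lambda>(m, n). a (m, n) *\<^sub>C (upow U m * upow V n)) has_sum x) UNIV"

definition smooth_torus :: "'a::cstar_algebra \<Rightarrow> 'a \<Rightarrow> 'a set" where
  "smooth_torus U V = {x. \<exists>a. smooth_expansion U V a x}"

text \<open>
  In the noncommutative torus the coefficient family of a smooth element is unique. The trace and
  the derivations below are meaningful on \<open>smooth_torus U V\<close> only.
\<close>

definition torus_coeff :: "'a::cstar_algebra \<Rightarrow> 'a \<Rightarrow> 'a \<Rightarrow> int \<times> int \<Rightarrow> complex" where
  "torus_coeff U V x = (THE a. smooth_expansion U V a x)"

definition torus_trace :: "'a::cstar_algebra \<Rightarrow> 'a \<Rightarrow> 'a \<Rightarrow> complex" where
  "torus_trace U V x = torus_coeff U V x (0, 0)"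

text \<open>
  The derivations with \<open>\<partial>\<^sub>1 U = 2\<pi>i U\<close>, \<open>\<partial>\<^sub>1 V = 0\<close> and \<open>\<partial>\<^sub>2 U = 0\<close>, \<open>\<partial>\<^sub>2 V = 2\<pi>i V\<close> multiply
  \<open>U\<^sup>m V\<^sup>n\<close> by \<open>2\<pi>i m\<close> and \<open>2\<pi>i n\<close> respectively, and are extended termwise.
\<close>

definition torus_deriv1 :: "'a::cstar_algebra \<Rightarrow> 'a \<Rightarrow> 'a \<Rightarrow> 'a" where
  "torus_deriv1 U V x = (\<Sum>\<^sub>\<infinity>(m, n). (2 * of_real pi * \<i> * of_int m * torus_coeff U V x (m, n)) *\<^sub>C
     (upow U m * upow V n))"

definition torus_deriv2 :: "'a::cstar_algebra \<Rightarrow> 'a \<Rightarrow> 'a \<Rightarrow> 'a" where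
  "torus_deriv2 U V x = (\<Sum>\<^sub>\<infinity>(m, n). (2 * of_real pi * \<i> * of_int n * torus_coeff U V x (m, n)) *\<^sub>C
     (upow U m * upow V n))"

text \<open>The Gauss--Bonnet term \<open>\<Omega>\<^sub>f(t)\<close> of the metric \<open>diag(exp(tf), 1)\<close>.\<close>

definition gauss_bonnet_term :: "'a::cstar_algebra \<Rightarrow> 'a \<Rightarrow> 'a \<Rightarrow> real \<Rightarrow> complex" where
  "gauss_bonnet_term U V f t = 1 / 2 * torus_trace U V
     (torus_deriv2 U V (exp (- (t / 2) *\<^sub>R f)) * torus_deriv2 U V (exp (t *\<^sub>R f)) +
      torus_deriv2 U V (exp ((t / 2) *\<^sub>R f)) * torus_deriv2 U V (exp (t *\<^sub>R f)) * exp (- t *\<^sub>R f))"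

end

theory Submission
  imports Defs
begin

text \<open>
  Write \<open>\<partial>\<close> for \<open>\<partial>\<^sub>2\<close> and \<open>q = \<partial>p\<close>. As \<open>p\<close> is a projection, \<open>exp(sp) = 1 + (exp(s) - 1) p\<close>, hence
  \<open>\<partial> exp(sp) = (exp(s) - 1) q\<close>. The Leibniz rule gives \<open>q = qp + pq\<close>, and then the trace property
  gives \<open>2 \<tau>(q\<^sup>2p) = \<tau>(q\<^sup>2)\<close>. Inserting this in the definition of \<open>\<Omega>\<^sub>p(t)\<close> yields, with \<open>r = exp(t/2)\<close>,
  \<open>\<Omega>\<^sub>p(t) = (r - 1)\<^sup>3 (r\<^sup>2 - 1) / (4r\<^sup>2) \<cdot> \<tau>(q\<^sup>2)\<close> (\<open>gauss_bonnet_term_idempotent\<close>).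
  Since \<open>q\<close> is self-adjoint and \<open>\<tau>\<close> is faithful (\<open>trace_star_mult_self_eq_0\<close>), this vanishes for no
  \<open>t \<noteq> 0\<close> unless \<open>q = 0\<close>; the interval \<open>0 < t < 2\<close> will do. And \<open>q \<noteq> 0\<close> in either case of the
  hypothesis: if \<open>q = 0\<close>, then \<open>p\<close> is a series in the powers of \<open>U\<close> alone, and so is \<open>\<partial>\<^sub>1p\<close>,
  so that \<open>p\<close> commutes with \<open>\<partial>\<^sub>1p\<close> (\<open>commute_deriv1_if_deriv2_eq_0\<close>).

  All this is computed with Fourier coefficients. Products of smooth elements correspond to twisted
  convolutions of their coefficients (\<open>expansion_mult\<close>), and Leibniz rule, trace property
  and faithfulness become identities between coefficients. The substantial point is that a smooth
  element determines its coefficients (\<open>weyl_series_eq_0\<close>). For this the series is averaged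
  over finitely many gauge automorphisms \<open>U \<mapsto> \<lambda>U\<close>, \<open>V \<mapsto> \<mu>V\<close>, with roots of unity \<open>\<lambda>\<close>, \<open>\<mu>\<close>, which isolates
  one coefficient up to a small error. The universal property supplies these automorphisms as
  algebraic homomorphisms; that they are norm decreasing, and so may be applied to infinite sums, is
  proved from the C*-identity by writing a self-adjoint element of norm less than one as the mean of
  a unitary and its adjoint (\<open>star_hom_contractive\<close>).
\<close>

section \<open>Elementary facts on C*-algebras\<close>

lemma scaleC_one [simp]: "1 *\<^sub>C x = (x::'a::cstar_algebra)"
  using scaleC_of_real[of 1 x] by simp

lemma bounded_bilinear_scaleC: "bounded_bilinear (scaleC :: complex \<Rightarrow> 'a::cstar_algebra \<Rightarrow> 'a)"
proof (rule bounded_bilinear.intro)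
  fix r :: real and c :: complex and x :: 'a
  show "(r *\<^sub>R c) *\<^sub>C x = r *\<^sub>R (c *\<^sub>C x)"
    by (metis scaleC_of_real scaleC_scaleC scaleR_conv_of_real)
  show "c *\<^sub>C (r *\<^sub>R x) = r *\<^sub>R (c *\<^sub>C x)"
    by (metis scaleC_of_real scaleC_scaleC mult.commute)
  show "\<exists>K. \<forall>a b. norm (a *\<^sub>C b :: 'a) \<le> norm a * norm b * K"
    by (intro exI[of _ 1]) (simp add: norm_scaleC)
qed (simp_all add: scaleC_add_left scaleC_add_right)

interpretation scaleC: bounded_bilinear "scaleC :: complex \<Rightarrow> 'a::cstar_algebra \<Rightarrow> 'a"
  by (rule bounded_bilinear_scaleC)

declare scaleC.zero_left [simp] scaleC.zero_right [simp]

lemma star_scaleR [simp]: "star (r *\<^sub>R x) = r *\<^sub>R star (x::'a::cstar_algebra)"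
  by (metis complex_cnj_complex_of_real scaleC_of_real star_scaleC)

lemma star_one [simp]: "star 1 = (1::'a::cstar_algebra)"
  by (metis mult_1_left mult_1_right star_mult star_star)

text \<open>From \<open>\<parallel>x\<parallel>\<^sup>2 = \<parallel>x\<^sup>* x\<parallel> \<le> \<parallel>x\<^sup>*\<parallel> \<parallel>x\<parallel>\<close>, applied to \<open>x\<close> and to \<open>x\<^sup>*\<close>.\<close>
lemma norm_star [simp]: "norm (star x) = norm (x::'a::cstar_algebra)"
proof -
  have le: "norm y \<le> norm (star y)" for y :: 'a
  proof (cases "y = 0")
    case False
    have "norm y * norm y \<le> norm (star y) * norm y"
      using norm_mult_ineq[of "star y" y] norm_star_mult_self[of y] by (simp add: power2_eq_square)
    with False show ?thesis by simp
  qed simp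
  show ?thesis
    using le[of x] le[of "star x"] by (simp add: star_star)
qed

lemma bounded_linear_star: "bounded_linear (star :: 'a::cstar_algebra \<Rightarrow> 'a)"
  by (rule bounded_linear_intro[where K = 1]) (simp_all add: star_add)

lemma norm_unitary_mult:
  fixes u :: "'a::cstar_algebra"
  assumes "star u * u = 1"
  shows "norm (u * x) = norm x"
proof -
  have "star (u * x) * (u * x) = star x * (star u * u) * x"
    by (simp add: star_mult mult.assoc)
  hence "(norm (u * x))\<^sup>2 = (norm x)\<^sup>2"
    by (metis assms mult_1_right norm_star_mult_self)
  thus ?thesis by simp
qed

section \<open>Star homomorphisms are contractive\<close>

text \<open>A crude bound, enough for the binomial series to converge absolutely in the open unit ball.\<close>
lemma abs_half_gbinomial_le_1: "\<bar>(1/2 :: real) gchoose n\<bar> \<le> 1"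
proof (induction n)
  case (Suc n)
  have "(1/2::real) * (1/2 gchoose n) =
        of_nat n * (1/2 gchoose n) + of_nat (Suc n) * (1/2 gchoose Suc n)"
    by (rule gbinomial_mult_1)
  hence "of_nat (Suc n) * (1/2 gchoose Suc n) = (1/2 - real n) * (1/2 gchoose n)"
    by (simp add: algebra_simps)
  hence "real (Suc n) * \<bar>1/2 gchoose Suc n\<bar> = \<bar>1/2 - real n\<bar> * \<bar>1/2 gchoose n\<bar>"
    by (metis abs_mult abs_of_nat)
  also have "\<dots> \<le> real (Suc n) * 1"
    by (intro mult_mono Suc.IH) auto
  finally show ?case by simp
qed simp

text \<open>
  The square root of \<open>1 - y\<close> is the binomial series \<open>\<Sum>n. (1/2 choose n) (-y)\<^sup>n\<close>; its square is
  computed by the Cauchy product and Vandermonde's identity.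
\<close>
lemma sqrt_one_minus:
  fixes y :: "'a::cstar_algebra"
  assumes "star y = y" "norm y < 1"
  obtains k where "star k = k" "k * k = 1 - y" "\<And>h. h * y = y * h \<Longrightarrow> h * k = k * h"
proof -
  define b :: "nat \<Rightarrow> real" where "b n = (- 1) ^ n * (1/2 gchoose n)" for n
  define f where "f n = b n *\<^sub>R y ^ n" for n
  define k where "k = suminf f"
  have b_le: "\<bar>b n\<bar> \<le> 1" for n
    using abs_half_gbinomial_le_1[of n] by (simp add: b_def abs_mult)
  have summ: "summable (\<lambda>n. norm (f n))"
  proof (rule summable_comparison_test')
    show "summable (\<lambda>n. norm y ^ n)"
      using assms(2) by (intro summable_geometric) simp
    show "norm (norm (f n)) \<le> norm y ^ n" if "n \<ge> 0" for n
      unfolding f_def using mult_mono[OF b_le[of n] norm_power_ineq[of y n]] by simp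
  qed
  have sf: "summable f"
    using summ by (rule summable_norm_cancel)
  have star_pow: "star (y ^ n) = y ^ n" for n
    by (induction n) (simp_all add: star_mult assms(1) power_commutes)
  have "star k = (\<Sum>n. star (f n))"
    unfolding k_def by (rule bounded_linear.suminf[OF bounded_linear_star sf])
  also have "\<dots> = k"
    by (simp add: star_pow f_def[abs_def] k_def)
  finally have 1: "star k = k" .
  have 2: "h * k = k * h" if "h * y = y * h" for h
  proof -
    have comm: "h * y ^ n = y ^ n * h" for n
    proof (induction n)
      case (Suc n)
      have "h * y ^ Suc n = y * (h * y ^ n)"
        using that by (simp flip: mult.assoc)
      thus ?case by (simp add: Suc mult.assoc)
    qed simp
    have "h * k = (\<Sum>n. h * f n)"
      unfolding k_def by (rule bounded_linear.suminf[OF bounded_linear_mult_right sf])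
    also have "\<dots> = (\<Sum>n. f n * h)"
      by (simp add: f_def comm)
    also have "\<dots> = k * h"
      unfolding k_def by (rule bounded_linear.suminf[OF bounded_linear_mult_left sf, symmetric])
    finally show ?thesis .
  qed
  have coeff: "(\<Sum>i\<le>n. f i * f (n - i)) = ((- 1) ^ n * (1 gchoose n)) *\<^sub>R y ^ n" for n
  proof -
    have "f i * f (n - i) = ((- 1) ^ n * ((1/2 gchoose i) * (1/2 gchoose (n - i)))) *\<^sub>R y ^ n"
      if "i \<le> n" for i
    proof -
      have "(- 1 :: real) ^ i * (- 1) ^ (n - i) = (- 1) ^ n" "y ^ i * y ^ (n - i) = y ^ n"
        using that by (simp_all flip: power_add)
      thus ?thesis
        by (simp add: f_def b_def) (metis mult.assoc mult.commute)
    qed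
    hence "(\<Sum>i\<le>n. f i * f (n - i)) =
        (\<Sum>i\<le>n. ((- 1) ^ n * ((1/2 gchoose i) * (1/2 gchoose (n - i)))) *\<^sub>R y ^ n)"
      by simp
    also have "\<dots> = ((- 1) ^ n * (\<Sum>i=0..n. (1/2 gchoose i) * (1/2 gchoose (n - i)))) *\<^sub>R y ^ n"
      by (simp add: scaleR_sum_left sum_distrib_left atLeast0AtMost)
    finally show ?thesis
      by (simp add: gbinomial_Vandermonde)
  qed
  have one_gchoose: "((1::real) gchoose n) = real (1 choose n)" for n
    by (metis binomial_gbinomial of_nat_1)
  have "(\<lambda>n. \<Sum>i\<le>n. f i * f (n - i)) sums (k * k)"
    unfolding k_def by (rule Cauchy_product_sums[OF summ summ])
  moreover have "(\<lambda>n. \<Sum>i\<le>n. f i * f (n - i)) sums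
      (\<Sum>n\<in>{0,1}. (\<Sum>i\<le>n. f i * f (n - i)))"
    by (rule sums_finite) (auto simp: coeff one_gchoose)
  ultimately have "k * k = (\<Sum>n\<in>{0,1}. (\<Sum>i\<le>n. f i * f (n - i)))"
    by (rule sums_unique2)
  also have "\<dots> = 1 - y"
    by (simp only: coeff) simp
  finally have 3: "k * k = 1 - y" .
  from that[OF 1 3 2] show ?thesis by blast
qed

text \<open>
  The unitary is \<open>u = h + ik\<close> with \<open>k = \<surd>(1 - h\<^sup>2)\<close>: as \<open>h\<close> and \<open>k\<close> are self-adjoint and commute,
  \<open>u\<^sup>* u = h\<^sup>2 + k\<^sup>2 = 1\<close>.
\<close>
lemma selfadjoint_eq_mean_unitary:
  fixes h :: "'a::cstar_algebra"
  assumes "star h = h" "norm h < 1"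
  obtains u where "star u * u = 1" "h = (1/2) *\<^sub>R (u + star u)"
proof -
  have "norm (h * h) < 1"
    using assms by (metis norm_star_mult_self abs_norm_cancel abs_square_less_1)
  then obtain k where k: "star k = k" "k * k = 1 - h * h" "h * k = k * h"
    using sqrt_one_minus[of "h * h"] assms(1) by (metis star_mult mult.assoc)
  define u where "u = h + \<i> *\<^sub>C k"
  have star_u: "star u = h - \<i> *\<^sub>C k"
    by (simp add: u_def star_add star_scaleC assms(1) k scaleC.minus_left)
  have "star u * u = h * h + k * k"
    unfolding star_u unfolding u_def
    by (simp add: algebra_simps mult_scaleC_left mult_scaleC_right scaleC_scaleC k(3)
        scaleC.diff_right scaleC.minus_left)
  moreover have "h = (1/2) *\<^sub>R (u + star u)"
    unfolding star_u unfolding u_def by (simp flip: scaleR_2)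
  ultimately show ?thesis using that k(2) by simp
qed

text \<open>
  A homomorphism sends a unitary to a unitary, hence the mean of a unitary and its adjoint to an
  element of norm at most one. This bounds it on self-adjoint elements, and the C*-identity
  transfers the bound to all elements.
\<close>
lemma star_hom_contractive:
  fixes \<phi> :: "'a::cstar_algebra \<Rightarrow> 'b::cstar_algebra"
  assumes lin: "\<And>x y. \<phi> (x + y) = \<phi> x + \<phi> y" "\<And>r x. \<phi> (r *\<^sub>R x) = r *\<^sub>R \<phi> x"
    and mult: "\<And>x y. \<phi> (x * y) = \<phi> x * \<phi> y" "\<phi> 1 = 1"
    and star: "\<And>x. \<phi> (star x) = star (\<phi> x)"
  shows "norm (\<phi> x) \<le> norm x"
proof -
  have unit_ball: "norm (\<phi> h) \<le> 1" if h: "star h = h" "norm h < 1" for h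
  proof -
    obtain u where u: "star u * u = 1" "h = (1/2) *\<^sub>R (u + star u)"
      using selfadjoint_eq_mean_unitary[OF h] .
    have "star (\<phi> u) * \<phi> u = 1"
      using u(1) by (metis mult star)
    hence "norm (\<phi> u) = 1"
      using norm_unitary_mult[of "\<phi> u" 1] by simp
    moreover have "\<phi> h = (1/2) *\<^sub>R (\<phi> u + star (\<phi> u))"
      by (subst u(2)) (simp only: lin star)
    ultimately show ?thesis
      using norm_triangle_ineq[of "\<phi> u" "star (\<phi> u)"] by simp
  qed
  have selfadj: "norm (\<phi> h) \<le> norm h" if h: "star h = h" for h
  proof (rule field_le_epsilon)
    fix e :: real assume e: "e > 0"
    define c where "c = norm h + e"
    have c: "c > 0" "norm h < c"
      using e by (auto simp: c_def add_nonneg_pos)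
    have "norm (\<phi> ((1/c) *\<^sub>R h)) \<le> 1"
      by (rule unit_ball) (use h c in simp_all)
    thus "norm (\<phi> h) \<le> norm h + e"
      using c by (simp add: lin c_def field_simps)
  qed
  have "(norm (\<phi> x))\<^sup>2 = norm (\<phi> (star x * x))"
    by (simp add: mult star norm_star_mult_self)
  also have "\<dots> \<le> norm (star x * x)"
    by (rule selfadj) (simp add: star_mult star_star)
  finally show ?thesis
    by (simp add: norm_star_mult_self)
qed

section \<open>Commutation of powers of the generators\<close>

lemma upow_0 [simp]: "upow u 0 = 1"
  by (simp add: upow_def)

lemma star_power: "star (x ^ n) = star (x::'a::cstar_algebra) ^ n"
  by (induction n) (simp_all add: star_mult power_commutes)

lemma star_upow: "star (upow u m) = upow u (- m)"
  by (cases "m = 0") (auto simp: upow_def star_power star_star)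

lemma upow_add_1:
  assumes "star u * u = 1" "u * star u = 1"
  shows "upow u (m + 1) = u * upow u m"
proof (cases "m \<ge> 0")
  case True
  thus ?thesis by (simp add: upow_def nat_add_distrib)
next
  case False
  define n where "n = nat (- m - 1)"
  have "nat (- m) = Suc n" and m: "m = - int n - 1"
    using False by (auto simp: n_def)
  hence "u * upow u m = (u * star u) * star u ^ n"
    using False by (simp add: upow_def mult.assoc)
  also have "\<dots> = upow u (m + 1)"
    by (simp add: assms upow_def m)
  finally show ?thesis by simp
qed

lemma upow_add:
  assumes "star u * u = 1" "u * star u = 1"
  shows "upow u (m + n) = upow u m * upow u n"
proof (induction m rule: int_induct[where k = 0])
  case (step1 i)
  have "upow u (i + 1 + n) = u * upow u (i + n)"
    using upow_add_1[OF assms, of "i + n"] by (simp add: add_ac)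
  thus ?case by (simp add: step1 upow_add_1[OF assms] mult.assoc)
next
  case (step2 i)
  have "u * upow u (i - 1 + n) = upow u (i + n)"
    using upow_add_1[OF assms, of "i - 1 + n"] by (simp add: add_ac)
  also have "\<dots> = u * (upow u (i - 1) * upow u n)"
    using upow_add_1[OF assms, of "i - 1"] by (simp add: step2 mult.assoc)
  finally have "star u * u * upow u (i - 1 + n) = star u * u * (upow u (i - 1) * upow u n)"
    by (simp only: mult.assoc)
  thus ?case by (simp add: assms)
qed simp

lemma upow_cis_scaleC: "upow (cis r *\<^sub>C u) m = cis (r * of_int m) *\<^sub>C upow u m"
proof -
  have "(c *\<^sub>C x) ^ n = c ^ n *\<^sub>C x ^ n" for c and x :: 'a and n
    by (induction n) (simp_all add: mult_scaleC_left mult_scaleC_right scaleC_scaleC mult_ac)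
  thus ?thesis
    by (auto simp: upow_def star_scaleC cis_cnj Complex.DeMoivre mult_ac)
qed

text \<open>A relation \<open>x u = \<lambda> u x\<close> with \<open>\<bar>\<lambda>\<bar> = 1\<close> passes to \<open>x u\<^sup>* = \<lambda>\<^sup>-\<^sup>1 u\<^sup>* x\<close>.\<close>
lemma twisted_commute_upow:
  assumes u: "star u * u = 1" "u * star u = 1"
    and comm: "x * u = cis r *\<^sub>C (u * x)"
  shows "x * upow u n = cis (r * of_int n) *\<^sub>C (upow u n * x)"
proof (induction n rule: int_induct[where k = 0])
  case (step1 i)
  have "x * upow u (i + 1) = (x * u) * upow u i"
    by (simp add: upow_add_1[OF u] mult.assoc)
  also have "\<dots> = cis r *\<^sub>C (u * (x * upow u i))"
    by (simp add: comm mult_scaleC_left mult.assoc)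
  also have "\<dots> = cis (r + r * of_int i) *\<^sub>C (upow u (i + 1) * x)"
    by (simp add: step1 upow_add_1[OF u] mult_scaleC_right scaleC_scaleC cis_mult mult.assoc)
  finally show ?case
    by (simp add: distrib_left add.commute)
next
  case (step2 i)
  have upow_i: "upow u i = u * upow u (i - 1)"
    using upow_add_1[OF u, of "i - 1"] by simp
  have "cis r *\<^sub>C (u * (x * upow u (i - 1))) = (x * u) * upow u (i - 1)"
    by (simp add: comm mult_scaleC_left mult.assoc)
  also have "\<dots> = x * upow u i"
    by (simp add: upow_i mult.assoc)
  also have "\<dots> = cis (r * of_int i) *\<^sub>C (upow u i * x)"
    by (rule step2.IH)
  also have "\<dots> = cis (r * of_int i) *\<^sub>C (u * (upow u (i - 1) * x))"
    by (simp add: upow_i mult.assoc)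
  finally have "cis (- r) *\<^sub>C (star u * (cis r *\<^sub>C (u * (x * upow u (i - 1))))) =
      cis (- r) *\<^sub>C (star u * (cis (r * of_int i) *\<^sub>C (u * (upow u (i - 1) * x))))"
    by simp
  moreover have "star u * (u * y) = y" for y
    using u(1) by (metis mult.assoc mult_1_left)
  ultimately show ?case
    by (simp add: mult_scaleC_right scaleC_scaleC cis_mult algebra_simps)
qed simp

locale rotation_relation =
  fixes \<theta> :: real and U V :: "'a::cstar_algebra"
  assumes rotation_pair: "rotation_pair \<theta> cstar_of_type U V"
begin

lemma unitary_U: "star U * U = 1" "U * star U = 1"
  and unitary_V: "star V * V = 1" "V * star V = 1"
  and UV: "U * V = cis (2 * pi * \<theta>) *\<^sub>C (V * U)"
  using rotation_pair
  by (simp_all add: rotation_pair_def unitary_in_def cstar_of_type_def cis_conv_exp mult_ac)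

definition weyl :: "int \<times> int \<Rightarrow> 'a" where
  "weyl k = upow U (fst k) * upow V (snd k)"

text \<open>
  The cocycle of the twisted convolution: \<open>phase j k\<close> is the scalar that arises when the power of \<open>V\<close>
  in \<open>weyl j\<close> is moved past the power of \<open>U\<close> in \<open>weyl k\<close>.
\<close>
definition phase :: "int \<times> int \<Rightarrow> int \<times> int \<Rightarrow> complex" where
  "phase j k = cis (- 2 * pi * \<theta> * of_int (snd j * fst k))"

lemma weyl_0 [simp]: "weyl 0 = 1"
  by (simp add: weyl_def)

lemma norm_phase [simp]: "cmod (phase j k) = 1"
  by (simp add: phase_def)

lemma norm_weyl [simp]: "norm (weyl k) = 1"
proof -
  have "star (upow U m) * upow U m = 1" "star (upow V m) * upow V m = 1" for m
    by (simp_all add: star_upow flip: upow_add[OF unitary_U] upow_add[OF unitary_V])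
  thus ?thesis
    using norm_unitary_mult[of "upow U (fst k)" "upow V (snd k)"]
      norm_unitary_mult[of "upow V (snd k)" 1]
    by (simp add: weyl_def)
qed

text \<open>
  Obtained from \<open>VU = \<lambda>\<^sup>-\<^sup>1 UV\<close> by passing first to powers of \<open>U\<close>, then, with the roles of the two
  factors exchanged, to powers of \<open>V\<close>.
\<close>
lemma upow_V_upow_U:
  "upow V n * upow U m = cis (- 2 * pi * \<theta> * of_int (n * m)) *\<^sub>C (upow U m * upow V n)"
proof -
  have "V * U = cis (- 2 * pi * \<theta>) *\<^sub>C (U * V)"
    by (simp add: UV scaleC_scaleC cis_mult)
  from twisted_commute_upow[OF unitary_U this]
  have "V * upow U m = cis (- 2 * pi * \<theta> * of_int m) *\<^sub>C (upow U m * V)" .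
  hence "upow U m * V = cis (2 * pi * \<theta> * of_int m) *\<^sub>C (V * upow U m)"
    by (simp add: scaleC_scaleC cis_mult)
  from twisted_commute_upow[OF unitary_V this, of n] show ?thesis
    by (simp add: scaleC_scaleC cis_mult algebra_simps)
qed

lemma weyl_mult: "weyl j * weyl k = phase j k *\<^sub>C weyl (j + k)"
proof -
  have "weyl j * weyl k =
      upow U (fst j) * (upow V (snd j) * upow U (fst k)) * upow V (snd k)"
    by (simp add: weyl_def mult.assoc)
  also have "\<dots> = phase j k *\<^sub>C
      ((upow U (fst j) * upow U (fst k)) * (upow V (snd j) * upow V (snd k)))"
    by (simp only: upow_V_upow_U mult_scaleC_left mult_scaleC_right phase_def mult.assoc)
  finally show ?thesis
    by (simp add: weyl_def flip: upow_add[OF unitary_U] upow_add[OF unitary_V])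
qed

lemma star_weyl: "star (weyl k) = phase k k *\<^sub>C weyl (- k)"
  by (simp add: weyl_def star_mult star_upow upow_V_upow_U phase_def)

end

section \<open>Rapidly decreasing families\<close>

definition weight :: "int \<times> int \<Rightarrow> real" where
  "weight k = 1 + \<bar>of_int (fst k)\<bar> + \<bar>of_int (snd k)\<bar>"

lemma weight_ge_1: "1 \<le> weight k"
  by (simp add: weight_def)

lemma weight_pos: "0 < weight k" "0 \<le> weight k"
  using weight_ge_1[of k] by simp_all

text \<open>
  Submultiplicativity of the weight is what makes rapid decrease survive a convolution.
\<close>
lemma weight_add_le: "weight (j + k) \<le> weight j * weight k"
proof -
  have "weight (j + k) \<le> weight j + weight k - 1"
    by (simp add: weight_def)
  also have "\<dots> \<le> weight j * weight k"
    using mult_nonneg_nonneg[of "weight j - 1" "weight k - 1"] weight_ge_1[of j] weight_ge_1[of k]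
    by (simp add: algebra_simps)
  finally show ?thesis .
qed

lemma rapidly_decreasing_iff:
  "rapidly_decreasing a \<longleftrightarrow> (\<forall>l. \<exists>C. \<forall>k. weight k ^ l * cmod (a k) \<le> C)"
  by (simp add: rapidly_decreasing_def weight_def)

lemma rapidly_decreasing_add:
  assumes "rapidly_decreasing a" "rapidly_decreasing b"
  shows "rapidly_decreasing (\<lambda>k. a k + b k)"
  unfolding rapidly_decreasing_iff
proof
  fix l
  obtain C D where C: "\<And>k. weight k ^ l * cmod (a k) \<le> C"
    and D: "\<And>k. weight k ^ l * cmod (b k) \<le> D"
    using assms unfolding rapidly_decreasing_iff by meson
  have "weight k ^ l * cmod (a k + b k) \<le> C + D" for k
  proof -
    have "weight k ^ l * cmod (a k + b k) \<le> weight k ^ l * (cmod (a k) + cmod (b k))"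
      by (intro mult_left_mono norm_triangle_ineq zero_le_power weight_pos)
    with C[of k] D[of k] show ?thesis by (simp add: algebra_simps)
  qed
  thus "\<exists>C. \<forall>k. weight k ^ l * cmod (a k + b k) \<le> C" by blast
qed

lemma rapidly_decreasing_cmult:
  assumes "rapidly_decreasing a"
  shows "rapidly_decreasing (\<lambda>k. c * a k)"
  unfolding rapidly_decreasing_iff
proof
  fix l
  obtain C where C: "\<And>k. weight k ^ l * cmod (a k) \<le> C"
    using assms unfolding rapidly_decreasing_iff by meson
  have "weight k ^ l * cmod (c * a k) \<le> cmod c * C" for k
    using mult_left_mono[OF C[of k], of "cmod c"] by (simp add: norm_mult mult_ac)
  thus "\<exists>C. \<forall>k. weight k ^ l * cmod (c * a k) \<le> C" by blast
qed

lemma rapidly_decreasing_snd_mult: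
  assumes "rapidly_decreasing a"
  shows "rapidly_decreasing (\<lambda>k. of_int (snd k) * a k)"
  unfolding rapidly_decreasing_iff
proof
  fix l
  obtain C where C: "\<And>k. weight k ^ Suc l * cmod (a k) \<le> C"
    using assms unfolding rapidly_decreasing_iff by meson
  have "weight k ^ l * cmod (of_int (snd k) * a k) \<le> C" for k
  proof -
    have "cmod (of_int (snd k) * a k) \<le> weight k * cmod (a k)"
      by (simp add: norm_mult weight_def mult_right_mono)
    hence "weight k ^ l * cmod (of_int (snd k) * a k) \<le> weight k ^ l * (weight k * cmod (a k))"
      by (intro mult_left_mono zero_le_power weight_pos)
    also have "\<dots> \<le> C" using C[of k] by (simp add: mult_ac)
    finally show ?thesis .
  qed
  thus "\<exists>C. \<forall>k. weight k ^ l * cmod (of_int (snd k) * a k) \<le> C" by blast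
qed

lemma rapidly_decreasing_delta: "rapidly_decreasing (\<lambda>k. if k = 0 then c else 0)"
  unfolding rapidly_decreasing_iff
proof (intro allI exI)
  show "weight k ^ l * cmod (if k = 0 then c else 0) \<le> cmod c" for l k
    by (cases "k = 0") (simp_all add: weight_def)
qed

lemma summable_on_int_inverse_squares: "(\<lambda>m::int. 1 / (1 + \<bar>of_int m\<bar>)\<^sup>2 :: real) summable_on UNIV"
proof -
  let ?f = "\<lambda>m::int. 1 / (1 + \<bar>of_int m\<bar>)\<^sup>2 :: real"
  have "summable (\<lambda>n. 1 / (real n + 1)\<^sup>2)"
    using inverse_squares_sums by (simp add: sums_iff add_ac)
  hence *: "(\<lambda>n. 1 / (real n + 1)\<^sup>2) summable_on UNIV"
    by (subst summable_on_UNIV_nonneg_real_iff) auto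
  have "?f summable_on range int" "?f summable_on range (\<lambda>n. - int n)"
    using * by (auto simp: summable_on_reindex inj_on_def o_def add_ac)
  hence "?f summable_on (range int \<union> range (\<lambda>n. - int n))"
    by (rule summable_on_union)
  also have "range int \<union> range (\<lambda>n. - int n) = UNIV"
    by (auto simp: image_iff) (metis int_cases2)
  finally show ?thesis .
qed

lemma summable_on_product_nonneg:
  fixes f g :: "_ \<Rightarrow> real"
  assumes f: "f summable_on A" "\<And>x. 0 \<le> f x" and g: "g summable_on B" "\<And>y. 0 \<le> g y"
  shows "(\<lambda>(x, y). f x * g y) summable_on A \<times> B"
proof (rule summable_on_SigmaI)
  show "((\<lambda>y. case (x, y) of (x, y) \<Rightarrow> f x * g y) has_sum f x * infsum g B) B" for x
    using has_sum_cmult_right[OF has_sum_infsum[OF g(1)], of "f x"] by simp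
  show "(\<lambda>x. f x * infsum g B) summable_on A"
    by (rule summable_on_cmult_left[OF f(1)])
qed (simp add: f g)

text \<open>
  \<open>weight (m, n)\<close> is at least \<open>1 + \<bar>m\<bar>\<close> and at least \<open>1 + \<bar>n\<bar>\<close>, so its fourth power dominates the product
  of the squares of these, and the reciprocals of that product form a product of convergent series.
\<close>
lemma summable_on_inverse_weight: "(\<lambda>k. 1 / weight k ^ 4) summable_on UNIV"
proof -
  let ?f = "\<lambda>m::int. 1 / (1 + \<bar>of_int m\<bar>)\<^sup>2 :: real"
  have "(\<lambda>(m, n). ?f m * ?f n) summable_on UNIV \<times> UNIV"
    by (intro summable_on_product_nonneg summable_on_int_inverse_squares) auto
  hence "(\<lambda>k. norm (1 / weight k ^ 4)) summable_on UNIV \<times> UNIV"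
  proof (rule Infinite_Sum.abs_summable_on_comparison_test')
    fix k :: "int \<times> int"
    obtain m n where k: "k = (m, n)" by (cases k)
    have "(1 + \<bar>real_of_int m\<bar>)\<^sup>2 * (1 + \<bar>real_of_int n\<bar>)\<^sup>2 \<le> weight k ^ 2 * weight k ^ 2"
      by (intro mult_mono power_mono) (auto simp: weight_def k)
    hence "1 / (weight k ^ 2 * weight k ^ 2) \<le>
        1 / ((1 + \<bar>real_of_int m\<bar>)\<^sup>2 * (1 + \<bar>real_of_int n\<bar>)\<^sup>2)"
      by (rule divide_left_mono) (auto intro!: mult_pos_pos zero_less_power weight_pos)
    thus "norm (1 / weight k ^ 4) \<le> (case k of (m, n) \<Rightarrow> ?f m * ?f n)"
      by (simp add: k flip: power_add)
  qed
  thus ?thesis by (simp add: weight_pos)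
qed

text \<open>Four of the powers of the weight at disposal are spent on summability.\<close>
lemma rapidly_decreasing_summable:
  assumes "rapidly_decreasing a"
  shows "(\<lambda>k. weight k ^ l * cmod (a k)) summable_on UNIV"
proof -
  obtain C where C: "\<And>k. weight k ^ (l + 4) * cmod (a k) \<le> C"
    using assms unfolding rapidly_decreasing_iff by meson
  have "(\<lambda>k. C * (1 / weight k ^ 4)) summable_on UNIV"
    by (intro summable_on_cmult_right summable_on_inverse_weight)
  hence "(\<lambda>k. norm (weight k ^ l * cmod (a k))) summable_on UNIV"
  proof (rule Infinite_Sum.abs_summable_on_comparison_test')
    show "norm (weight k ^ l * cmod (a k)) \<le> C * (1 / weight k ^ 4)" for k
      using C[of k] weight_pos[of k] by (simp add: field_simps power_add abs_mult)
  qed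
  thus ?thesis by (simp add: weight_pos abs_mult)
qed

lemma rapidly_decreasing_abs_summable:
  "rapidly_decreasing a \<Longrightarrow> (\<lambda>k. cmod (a k)) summable_on UNIV"
  using rapidly_decreasing_summable[of a 0] by simp

section \<open>Uniqueness of the Fourier coefficients\<close>

lemma has_sum_finite_sum:
  fixes f :: "'i \<Rightarrow> 'x \<Rightarrow> 'b::topological_comm_monoid_add"
  assumes "finite I" "\<And>i. i \<in> I \<Longrightarrow> (f i has_sum s i) A"
  shows "((\<lambda>x. \<Sum>i\<in>I. f i x) has_sum (\<Sum>i\<in>I. s i)) A"
  using assms by (induction I rule: finite_induct) (auto intro: has_sum_add)

text \<open>Orthogonality of the characters of \<open>\<int>/K\<close>.\<close>
lemma sum_roots_of_unity_eq_0:
  fixes r :: int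
  assumes "r \<noteq> 0" "\<bar>r\<bar> < int K"
  shows "(\<Sum>j<K. cis (2 * pi / K * (of_nat j * of_int r))) = 0"
proof -
  define z where "z = cis (2 * pi * of_int r / of_nat K)"
  have K: "K > 0" using assms by auto
  have "z \<noteq> 1"
  proof
    assume "z = 1"
    hence "cos (2 * pi * of_int r / of_nat K) = 1"
      by (metis z_def cis.sel(1) one_complex.sel(1))
    then obtain n where "2 * pi * of_int r / of_nat K = 2 * pi * of_int n"
      unfolding cos_one_2pi_int by (auto simp: mult_ac)
    hence "real_of_int r = of_int (n * int K)"
      using K by (simp add: field_simps)
    hence "r = n * int K" by linarith
    thus False using assms zdvd_imp_le[of "int K" "\<bar>r\<bar>"] by simp
  qed
  moreover have "z ^ K = 1"
    using K by (simp add: z_def Complex.DeMoivre)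
  moreover have "(\<Sum>j<K. cis (2 * pi / K * (of_nat j * of_int r))) = (\<Sum>j<K. z ^ j)"
    by (simp add: z_def Complex.DeMoivre mult_ac)
  ultimately show ?thesis
    by (simp add: geometric_sum)
qed

locale nc_torus_pair =
  fixes \<theta> :: real and U V :: "'a::cstar_algebra"
  assumes nc_torus: "nc_torus \<theta> U V"
begin

sublocale rotation_relation
  by unfold_locales (use nc_torus in \<open>simp add: nc_torus_def\<close>)

text \<open>
  The gauge automorphism \<open>U \<mapsto> \<lambda>U\<close>, \<open>V \<mapsto> \<mu>V\<close> comes from the universal property, as \<open>\<lambda>U\<close>, \<open>\<mu>V\<close>
  satisfy the same relation as \<open>U\<close>, \<open>V\<close>. The universal property only gives an algebraic
  homomorphism; being contractive it may be applied term by term to infinite sums.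
\<close>
lemma gauge_automorphism:
  obtains \<phi> :: "'a \<Rightarrow> 'a"
  where "bounded_linear \<phi>"
    "\<And>c k. \<phi> (c *\<^sub>C weyl k) = (cis (r * of_int (fst k) + s * of_int (snd k)) * c) *\<^sub>C weyl k"
proof -
  have "(cis r *\<^sub>C U) * (cis s *\<^sub>C V) =
      cis (2 * pi * \<theta>) *\<^sub>C ((cis s *\<^sub>C V) * (cis r *\<^sub>C U))"
    by (simp add: UV mult_scaleC_left mult_scaleC_right scaleC_scaleC mult_ac)
  moreover have "cis (2 * pi * \<theta>) = exp (2 * of_real pi * \<i> * of_real \<theta>)"
    by (simp add: cis_conv_exp mult_ac)
  ultimately have rot: "rotation_pair \<theta> cstar_of_type (cis r *\<^sub>C U) (cis s *\<^sub>C V)"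
    by (simp add: rotation_pair_def unitary_in_def cstar_of_type_def star_scaleC mult_scaleC_left
        mult_scaleC_right scaleC_scaleC cis_cnj cis_mult unitary_U unitary_V)
  have "\<exists>!\<phi>. \<phi> \<in> unital_star_hom cstar_of_type cstar_of_type \<and>
      \<phi> U = cis r *\<^sub>C U \<and> \<phi> V = cis s *\<^sub>C V"
    using nc_torus[unfolded nc_torus_def, THEN conjunct2, THEN conjunct2, THEN spec, THEN spec,
        THEN spec, THEN mp, OF conjI[OF unital_cstar_algebra_cstar_of_type rot]] .
  then obtain \<phi> where \<phi>: "\<phi> \<in> unital_star_hom cstar_of_type cstar_of_type"
      "\<phi> U = cis r *\<^sub>C U" "\<phi> V = cis s *\<^sub>C V"
    by blast
  have hom: "\<phi> (x + y) = \<phi> x + \<phi> y" "\<phi> (x * y) = \<phi> x * \<phi> y" "\<phi> 1 = 1"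
    "\<phi> (c *\<^sub>C x) = c *\<^sub>C \<phi> x" "\<phi> (star x) = star (\<phi> x)" for x y c
    using \<phi>(1) by (auto simp: unital_star_hom_def ring_hom_def cstar_of_type_def)
  have scaleR: "\<phi> (t *\<^sub>R x) = t *\<^sub>R \<phi> x" for t x
    by (metis hom(4) scaleC_of_real)
  have pow: "\<phi> (x ^ n) = \<phi> x ^ n" for x n
    by (induction n) (simp_all add: hom)
  have "\<phi> (upow u m) = upow (\<phi> u) m" for u m
    by (simp add: upow_def pow hom)
  hence "\<phi> (c *\<^sub>C weyl k) = (cis (r * of_int (fst k) + s * of_int (snd k)) * c) *\<^sub>C weyl k" for c k
    by (simp add: weyl_def hom \<phi> upow_cis_scaleC mult_scaleC_left mult_scaleC_right scaleC_scaleC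
        mult_ac flip: cis_mult)
  moreover have "bounded_linear \<phi>"
    by (rule bounded_linear_intro[where K = 1])
      (simp_all add: hom scaleR star_hom_contractive)
  ultimately show ?thesis using that by blast
qed

text \<open>
  Fix \<open>k\<^sub>0\<close> and a finite set \<open>F\<close> outside which the coefficients have absolute sum at most \<open>e\<close>.
  Averaging the images of the series under the gauge automorphisms, with \<open>K\<close>-th roots of unity for
  \<open>\<lambda>\<close> and \<open>\<mu>\<close>, against the character of \<open>k\<^sub>0\<close> removes all terms but those with
  \<open>k \<equiv> k\<^sub>0\<close> modulo \<open>K\<close> in both components. For large \<open>K\<close> no such \<open>k\<close> but \<open>k\<^sub>0\<close> lies in \<open>F\<close>, hence
  \<open>\<bar>c k\<^sub>0\<bar> \<le> e\<close>.
\<close>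
lemma weyl_series_eq_0:
  assumes summable: "(\<lambda>k. cmod (c k)) summable_on UNIV"
    and sum0: "((\<lambda>k. c k *\<^sub>C weyl k) has_sum 0) UNIV"
  shows "c k0 = 0"
proof -
  have "cmod (c k0) \<le> 0 + e" if e: "e > 0" for e
  proof -
    obtain F where F: "finite F"
      "dist (sum (\<lambda>k. cmod (c k)) F) (infsum (\<lambda>k. cmod (c k)) UNIV) \<le> e"
      using infsum_finite_approximation[OF summable e] by auto
    define G where "G = insert k0 F"
    have G: "finite G" "k0 \<in> G" using F by (simp_all add: G_def)
    define tail where "tail = infsum (\<lambda>k. cmod (c k)) UNIV - sum (\<lambda>k. cmod (c k)) G"
    have "sum (\<lambda>k. cmod (c k)) F \<le> sum (\<lambda>k. cmod (c k)) G"
      by (rule sum_mono2) (use F in \<open>auto simp: G_def\<close>)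
    hence tail_le: "tail \<le> e"
      using F(2) by (simp add: tail_def dist_real_def)
    have tail: "((\<lambda>k. cmod (c k)) has_sum tail) (UNIV - G)"
      unfolding tail_def using summable G(1)
      by (intro has_sum_Diff has_sum_infsum has_sum_finite) auto
    \<comment> \<open>large enough for no point of \<open>G\<close> but \<open>k0\<close> to be congruent to \<open>k0\<close> modulo \<open>K\<close>\<close>
    define K where "K = Suc (nat (\<Sum>k\<in>G. \<bar>fst (k - k0)\<bar> + \<bar>snd (k - k0)\<bar>))"
    have K: "\<bar>fst (k - k0)\<bar> < int K" "\<bar>snd (k - k0)\<bar> < int K" if "k \<in> G" for k
      using member_le_sum[of k G "\<lambda>k. \<bar>fst (k - k0)\<bar> + \<bar>snd (k - k0)\<bar>"] that G
      by (auto simp: K_def)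
    have K0: "K > 0" by (simp add: K_def)
    define D :: "int \<Rightarrow> complex" where
      "D r = (\<Sum>j<K. cis (2 * pi / K * (of_nat j * of_int r)))" for r
    \<comment> \<open>\<open>K\<^sup>2\<close> times the factor by which the averaging multiplies the coefficient at \<open>k\<close>\<close>
    define w where "w k = D (fst (k - k0)) * D (snd (k - k0))" for k
    have D_le: "cmod (D r) \<le> K" for r
      unfolding D_def by (rule order_trans[OF norm_sum]) simp
    have w_le: "cmod (w k) \<le> real K * real K" for k
      unfolding w_def norm_mult by (intro mult_mono D_le) auto
    have "D 0 = of_nat K" by (simp add: D_def)
    hence w_k0: "w k0 = of_nat K * of_nat K"
      by (simp add: w_def)
    have w_0: "w k = 0" if "k \<in> G" "k \<noteq> k0" for k
    proof -
      have "fst (k - k0) \<noteq> 0 \<or> snd (k - k0) \<noteq> 0"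
        using that by (auto simp: prod_eq_iff)
      thus ?thesis
        using sum_roots_of_unity_eq_0 K[OF that(1)] unfolding w_def D_def mult_eq_0_iff by blast
    qed
    have "((\<lambda>k. (cis (2 * pi / K * (of_nat i * of_int (fst (k - k0)))) *
          cis (2 * pi / K * (of_nat j * of_int (snd (k - k0)))) * c k) *\<^sub>C weyl k) has_sum 0) UNIV"
      for i j :: nat
    proof -
      let ?r = "2 * pi / K * of_nat i" and ?s = "2 * pi / K * of_nat j"
      obtain \<phi> where \<phi>: "bounded_linear \<phi>"
        "\<And>c k. \<phi> (c *\<^sub>C weyl k) = (cis (?r * of_int (fst k) + ?s * of_int (snd k)) * c) *\<^sub>C weyl k"
        using gauge_automorphism by blast
      have "((\<lambda>k. cis (- (?r * of_int (fst k0) + ?s * of_int (snd k0))) *\<^sub>C \<phi> (c k *\<^sub>C weyl k))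
          has_sum cis (- (?r * of_int (fst k0) + ?s * of_int (snd k0))) *\<^sub>C \<phi> 0) UNIV"
        by (intro has_sum_bounded_linear[OF scaleC.bounded_linear_right]
            has_sum_bounded_linear[OF \<phi>(1)] sum0)
      moreover have eq: "cis (- (?r * of_int (fst k0) + ?s * of_int (snd k0))) *\<^sub>C \<phi> (c k *\<^sub>C weyl k) =
          (cis (2 * pi / K * (of_nat i * of_int (fst (k - k0)))) *
          cis (2 * pi / K * (of_nat j * of_int (snd (k - k0)))) * c k) *\<^sub>C weyl k" for k
      proof -
        have "- (?r * of_int (fst k0) + ?s * of_int (snd k0)) +
            (?r * of_int (fst k) + ?s * of_int (snd k)) =
            2 * pi / K * (of_nat i * of_int (fst (k - k0))) +
            2 * pi / K * (of_nat j * of_int (snd (k - k0)))"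
          by (simp add: right_diff_distrib)
        thus ?thesis
          by (simp only: \<phi>(2) scaleC_scaleC cis_mult mult.assoc[symmetric])
      qed
      ultimately show ?thesis
        by (simp only: eq linear_0[OF bounded_linear.linear[OF \<phi>(1)]] scaleC.zero_right)
    qed
    hence "((\<lambda>k. \<Sum>i<K. \<Sum>j<K. (cis (2 * pi / K * (of_nat i * of_int (fst (k - k0)))) *
          cis (2 * pi / K * (of_nat j * of_int (snd (k - k0)))) * c k) *\<^sub>C weyl k)
        has_sum (\<Sum>i<K. \<Sum>j<K. 0)) UNIV"
      by (intro has_sum_finite_sum) auto
    also have "(\<lambda>k. \<Sum>i<K. \<Sum>j<K. (cis (2 * pi / K * (of_nat i * of_int (fst (k - k0)))) *
          cis (2 * pi / K * (of_nat j * of_int (snd (k - k0)))) * c k) *\<^sub>C weyl k) =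
        (\<lambda>k. (w k * c k) *\<^sub>C weyl k)"
      by (simp only: w_def D_def sum_product) (simp only: sum_distrib_right scaleC.sum_left)
    finally have "((\<lambda>k. (w k * c k) *\<^sub>C weyl k) has_sum 0) UNIV"
      by simp
    moreover have "((\<lambda>k. (w k * c k) *\<^sub>C weyl k) has_sum (w k0 * c k0) *\<^sub>C weyl k0) G"
    proof (rule has_sum_finiteI[OF G(1)])
      have "(\<Sum>k\<in>G. (w k * c k) *\<^sub>C weyl k) = (\<Sum>k\<in>{k0}. (w k * c k) *\<^sub>C weyl k)"
        by (rule sum.mono_neutral_right) (use G w_0 in auto)
      thus "(w k0 * c k0) *\<^sub>C weyl k0 = (\<Sum>k\<in>G. (w k * c k) *\<^sub>C weyl k)"
        by simp
    qed
    ultimately have "((\<lambda>k. (w k * c k) *\<^sub>C weyl k) has_sum 0 - (w k0 * c k0) *\<^sub>C weyl k0) (UNIV - G)"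
      by (rule has_sum_Diff) simp
    moreover have "((\<lambda>k. (real K * real K) * cmod (c k)) has_sum (real K * real K) * tail) (UNIV - G)"
      by (intro has_sum_cmult_right tail)
    ultimately have "norm (0 - (w k0 * c k0) *\<^sub>C weyl k0) \<le> (real K * real K) * tail"
      by (rule norm_infsum_le) (auto simp: norm_scaleC norm_mult intro!: mult_right_mono w_le)
    hence "(real K * real K) * cmod (c k0) \<le> (real K * real K) * tail"
      by (simp add: norm_scaleC norm_mult w_k0)
    hence "cmod (c k0) \<le> tail"
      using K0 by simp
    thus ?thesis using tail_le by simp
  qed
  hence "cmod (c k0) \<le> 0"
    by (rule field_le_epsilon)
  thus ?thesis by simp
qed

end

section \<open>The algebra of smooth elements\<close>

context rotation_relation
begin

abbreviation expansion :: "(int \<times> int \<Rightarrow> complex) \<Rightarrow> 'a \<Rightarrow> bool" where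
  "expansion \<equiv> smooth_expansion U V"

lemma expansion_iff:
  "expansion a x \<longleftrightarrow> rapidly_decreasing a \<and> ((\<lambda>k. a k *\<^sub>C weyl k) has_sum x) UNIV"
  by (simp add: smooth_expansion_def weyl_def case_prod_unfold)

lemma expansion_summable:
  assumes "rapidly_decreasing a"
  shows "expansion a (\<Sum>\<^sub>\<infinity>k. a k *\<^sub>C weyl k)"
  unfolding expansion_iff
proof
  have "(\<lambda>k. norm (a k *\<^sub>C weyl k)) summable_on UNIV"
    using rapidly_decreasing_abs_summable[OF assms] by (simp add: norm_scaleC)
  thus "((\<lambda>k. a k *\<^sub>C weyl k) has_sum (\<Sum>\<^sub>\<infinity>k. a k *\<^sub>C weyl k)) UNIV"
    by (rule has_sum_infsum[OF abs_summable_summable])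
qed (fact assms)

lemma expansion_0: "expansion (\<lambda>_. 0) 0"
  unfolding expansion_iff rapidly_decreasing_iff by simp (metis order_refl)

lemma expansion_1: "expansion (\<lambda>k. if k = 0 then 1 else 0) 1"
  unfolding expansion_iff
proof
  show "((\<lambda>k. (if k = 0 then 1 else 0) *\<^sub>C weyl k) has_sum 1) UNIV"
    by (rule has_sum_finite_neutralI[of "{0}"]) auto
qed (rule rapidly_decreasing_delta)

lemma expansion_add:
  "expansion a x \<Longrightarrow> expansion b y \<Longrightarrow> expansion (\<lambda>k. a k + b k) (x + y)"
  by (auto simp: expansion_iff scaleC_add_left intro: rapidly_decreasing_add has_sum_add)

lemma expansion_scaleC:
  "expansion a x \<Longrightarrow> expansion (\<lambda>k. c * a k) (c *\<^sub>C x)"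
  using has_sum_bounded_linear[OF scaleC.bounded_linear_right[of c], where f = "\<lambda>k. a k *\<^sub>C weyl k"]
  by (auto simp: expansion_iff scaleC_scaleC intro: rapidly_decreasing_cmult)

lemma expansion_star:
  assumes "expansion a x"
  shows "expansion (\<lambda>k. cnj (a (- k)) * phase k k) (star x)"
  unfolding expansion_iff
proof
  show "rapidly_decreasing (\<lambda>k. cnj (a (- k)) * phase k k)"
    unfolding rapidly_decreasing_iff
  proof
    fix l
    obtain C where C: "\<And>k. weight k ^ l * cmod (a k) \<le> C"
      using assms unfolding expansion_iff rapidly_decreasing_iff by meson
    have "weight k ^ l * cmod (cnj (a (- k)) * phase k k) \<le> C" for k
      using C[of "- k"] by (simp add: norm_mult weight_def)
    thus "\<exists>C. \<forall>k. weight k ^ l * cmod (cnj (a (- k)) * phase k k) \<le> C" by blast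
  qed
  have "((\<lambda>k. star (a k *\<^sub>C weyl k)) has_sum star x) UNIV"
    by (rule has_sum_bounded_linear[OF bounded_linear_star]) (use assms in \<open>simp add: expansion_iff\<close>)
  hence "((\<lambda>k. star (a (- k) *\<^sub>C weyl (- k))) has_sum star x) UNIV"
    using has_sum_reindex_bij_betw[OF bij_uminus, of "\<lambda>k. star (a k *\<^sub>C weyl k)" "star x"] by simp
  moreover have "phase (- k) (- k) = phase k k" for k
    by (simp add: phase_def)
  ultimately show "((\<lambda>k. (cnj (a (- k)) * phase k k) *\<^sub>C weyl k) has_sum star x) UNIV"
    by (simp add: star_scaleC star_weyl scaleC_scaleC)
qed

text \<open>Twisted convolution, the product of smooth elements in terms of their coefficients.\<close>
definition tconv :: "(int \<times> int \<Rightarrow> complex) \<Rightarrow> (int \<times> int \<Rightarrow> complex) \<Rightarrow> int \<times> int \<Rightarrow> complex" where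
  "tconv a b s = (\<Sum>\<^sub>\<infinity>j. a j * b (s - j) * phase j (s - j))"

text \<open>
  Both claims come from one termwise estimate: \<open>weight s\<^sup>l \<le> weight j\<^sup>l weight (s - j)\<^sup>l\<close> distributes the
  weight over the two factors, of which the second is bounded by \<open>C\<close> and the first summable.
\<close>
lemma tconv_has_sum_and_bound:
  assumes a: "rapidly_decreasing a" and C: "\<And>k. weight k ^ l * cmod (b k) \<le> C"
  shows "((\<lambda>j. a j * b (s - j) * phase j (s - j)) has_sum tconv a b s) UNIV"
    and "weight s ^ l * cmod (tconv a b s) \<le> (\<Sum>\<^sub>\<infinity>j. weight j ^ l * cmod (a j)) * C"
proof -
  let ?t = "\<lambda>j. a j * b (s - j) * phase j (s - j)"
  let ?B = "\<lambda>j. weight j ^ l * cmod (a j) * C"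
  have B: "(?B has_sum (\<Sum>\<^sub>\<infinity>j. weight j ^ l * cmod (a j)) * C) UNIV"
    by (intro has_sum_cmult_left has_sum_infsum rapidly_decreasing_summable a)
  have le: "weight s ^ l * cmod (?t j) \<le> ?B j" for j
  proof -
    have "weight s ^ l \<le> (weight j * weight (s - j)) ^ l"
      using weight_add_le[of j "s - j"] by (intro power_mono weight_pos) simp
    hence "weight s ^ l * cmod (?t j) \<le>
        (weight j * weight (s - j)) ^ l * (cmod (a j) * cmod (b (s - j)))"
      unfolding norm_mult norm_phase mult_1_right by (rule mult_right_mono) simp
    also have "\<dots> = weight j ^ l * cmod (a j) * (weight (s - j) ^ l * cmod (b (s - j)))"
      by (simp add: power_mult_distrib mult_ac)
    also have "\<dots> \<le> ?B j"
      by (intro mult_left_mono C mult_nonneg_nonneg zero_le_power weight_pos norm_ge_zero)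
    finally show ?thesis .
  qed
  have "(\<lambda>j. norm (?t j)) summable_on UNIV"
  proof (rule Infinite_Sum.abs_summable_on_comparison_test'[OF has_sum_imp_summable[OF B]])
    fix j
    have "1 * cmod (?t j) \<le> weight s ^ l * cmod (?t j)"
      by (intro mult_right_mono one_le_power weight_ge_1 norm_ge_zero)
    thus "norm (?t j) \<le> ?B j" using le[of j] by simp
  qed
  thus *: "(?t has_sum tconv a b s) UNIV"
    unfolding tconv_def by (rule has_sum_infsum[OF abs_summable_summable])
  have "((\<lambda>j. of_real (weight s ^ l) * ?t j) has_sum of_real (weight s ^ l) * tconv a b s) UNIV"
    by (intro has_sum_cmult_right *)
  from norm_infsum_le[OF this B]
  have "cmod (of_real (weight s ^ l) * tconv a b s) \<le> (\<Sum>\<^sub>\<infinity>j. weight j ^ l * cmod (a j)) * C"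
    using le weight_pos[of s] by (simp add: norm_mult norm_power)
  thus "weight s ^ l * cmod (tconv a b s) \<le> (\<Sum>\<^sub>\<infinity>j. weight j ^ l * cmod (a j)) * C"
    using weight_pos[of s] by (simp add: norm_mult norm_power)
qed

lemma tconv_has_sum:
  assumes "rapidly_decreasing a" "rapidly_decreasing b"
  shows "((\<lambda>j. a j * b (s - j) * phase j (s - j)) has_sum tconv a b s) UNIV"
proof -
  obtain C where "\<And>k. weight k ^ 0 * cmod (b k) \<le> C"
    using assms(2) unfolding rapidly_decreasing_iff by meson
  from tconv_has_sum_and_bound(1)[OF assms(1) this] show ?thesis .
qed

lemma rapidly_decreasing_tconv:
  assumes "rapidly_decreasing a" "rapidly_decreasing b"
  shows "rapidly_decreasing (tconv a b)"
  unfolding rapidly_decreasing_iff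
proof
  fix l
  obtain C where "\<And>k. weight k ^ l * cmod (b k) \<le> C"
    using assms(2) unfolding rapidly_decreasing_iff by meson
  from tconv_has_sum_and_bound(2)[OF assms(1) this]
  show "\<exists>C. \<forall>s. weight s ^ l * cmod (tconv a b s) \<le> C" by blast
qed

text \<open>
  The double series \<open>\<Sum>j k. a\<^sub>j b\<^sub>k W\<^sub>j W\<^sub>k\<close>, with \<open>W\<^sub>j\<close> for \<open>weyl j\<close>, converges absolutely. Its sum by rows is \<open>xy\<close>;
  its sum along the lines \<open>j + k = s\<close> is the expansion with coefficients \<open>tconv a b\<close>.
\<close>
lemma expansion_mult:
  assumes "expansion a x" "expansion b y"
  shows "expansion (tconv a b) (x * y)"
  unfolding expansion_iff
proof
  let ?f = "\<lambda>j. a j *\<^sub>C weyl j" and ?g = "\<lambda>k. b k *\<^sub>C weyl k"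
  have rd: "rapidly_decreasing a" "rapidly_decreasing b"
    and sums: "(?f has_sum x) UNIV" "(?g has_sum y) UNIV"
    using assms by (simp_all add: expansion_iff)
  show "rapidly_decreasing (tconv a b)"
    by (rule rapidly_decreasing_tconv[OF rd])
  define h where "h p = ?f (fst p) * ?g (snd p)" for p
  have "(\<lambda>(j, k). cmod (a j) * cmod (b k)) summable_on UNIV \<times> UNIV"
    by (intro summable_on_product_nonneg rapidly_decreasing_abs_summable rd) auto
  hence "(\<lambda>p. norm (h p)) summable_on UNIV \<times> UNIV"
  proof (rule Infinite_Sum.abs_summable_on_comparison_test')
    show "norm (h p) \<le> (case p of (j, k) \<Rightarrow> cmod (a j) * cmod (b k))" for p
      using norm_mult_ineq[of "?f (fst p)" "?g (snd p)"]
      by (simp add: h_def norm_scaleC case_prod_unfold)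
  qed
  hence summable: "h summable_on UNIV \<times> UNIV"
    by (rule abs_summable_summable)
  have "(h has_sum x * y) (UNIV \<times> UNIV)"
  proof (rule has_sum_SigmaI[OF _ _ summable])
    show "((\<lambda>k. h (j, k)) has_sum ?f j * y) UNIV" for j
      unfolding h_def fst_conv snd_conv by (rule has_sum_cmult_right[OF sums(2)])
    show "((\<lambda>j. ?f j * y) has_sum x * y) UNIV"
      by (rule has_sum_cmult_left[OF sums(1)])
  qed
  moreover have bij: "bij_betw (\<lambda>(s, j). (j, s - j)) (UNIV \<times> UNIV) (UNIV \<times> (UNIV :: (int \<times> int) set))"
    by (rule bij_betwI[where g = "\<lambda>(j, k). (j + k, j)"]) (simp_all add: case_prod_unfold)
  ultimately have "((\<lambda>p. h ((\<lambda>(s, j). (j, s - j)) p)) has_sum x * y) (UNIV \<times> UNIV)"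
    by (subst has_sum_reindex_bij_betw[OF bij])
  thus "((\<lambda>s. tconv a b s *\<^sub>C weyl s) has_sum x * y) UNIV"
  proof (rule has_sum_SigmaD)
    fix s
    have "h (j, s - j) = (a j * b (s - j) * phase j (s - j)) *\<^sub>C weyl s" for j
      by (simp add: h_def mult_scaleC_left mult_scaleC_right scaleC_scaleC weyl_mult mult_ac)
    thus "((\<lambda>j. h ((\<lambda>(s, j). (j, s - j)) (s, j))) has_sum tconv a b s *\<^sub>C weyl s) UNIV"
      using has_sum_bounded_linear[OF scaleC.bounded_linear_left[of "weyl s"] tconv_has_sum[OF rd, of s]]
      by simp
  qed
qed

end

section \<open>The trace and the derivation\<close>

context nc_torus_pair
begin

lemma expansion_unique:
  assumes "expansion a x" "expansion b x"
  shows "a = b"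
proof
  fix k
  have "expansion (\<lambda>k. a k + (- 1) * b k) (x + (- 1) *\<^sub>C x)"
    by (intro expansion_add expansion_scaleC assms)
  moreover have "x + (- 1) *\<^sub>C x = 0"
    by (metis scaleC_one scaleC.add_left scaleC.zero_left add.right_inverse)
  ultimately have "a k + (- 1) * b k = 0"
    using weyl_series_eq_0 rapidly_decreasing_abs_summable unfolding expansion_iff by metis
  thus "a k = b k" by simp
qed

lemma torus_coeff_eq: "expansion a x \<Longrightarrow> torus_coeff U V x = a"
  unfolding torus_coeff_def by (rule the_equality) (auto intro: expansion_unique)

lemma torus_trace_eq: "expansion a x \<Longrightarrow> torus_trace U V x = a 0"
  by (simp add: torus_trace_def torus_coeff_eq zero_prod_def)

lemma expansion_eqI:
  assumes "expansion a x" "expansion b y" "\<And>k. a k = b k"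
  shows "x = y"
proof -
  have "a = b" using assms(3) by blast
  thus ?thesis using assms(1,2) has_sum_unique unfolding expansion_iff by blast
qed

abbreviation dcoeff :: "(int \<times> int \<Rightarrow> complex) \<Rightarrow> int \<times> int \<Rightarrow> complex" where
  "dcoeff a \<equiv> (\<lambda>k. 2 * of_real pi * \<i> * (of_int (snd k) * a k))"

lemma expansion_deriv2:
  assumes "expansion a x"
  shows "expansion (dcoeff a) (torus_deriv2 U V x)"
proof -
  have "torus_deriv2 U V x = (\<Sum>\<^sub>\<infinity>k. dcoeff a k *\<^sub>C weyl k)"
    by (simp add: torus_deriv2_def torus_coeff_eq[OF assms] weyl_def case_prod_unfold mult.assoc)
  moreover have "rapidly_decreasing (dcoeff a)"
    using assms unfolding expansion_iff
    by (intro rapidly_decreasing_cmult rapidly_decreasing_snd_mult) simp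
  ultimately show ?thesis using expansion_summable by simp
qed

abbreviation "smooth \<equiv> smooth_torus U V"
abbreviation "\<tau> \<equiv> torus_trace U V"
abbreviation "deriv2 \<equiv> torus_deriv2 U V"

lemma smoothI: "expansion a x \<Longrightarrow> x \<in> smooth"
  unfolding smooth_torus_def by (rule CollectI) (rule exI)

lemma smoothE:
  assumes "x \<in> smooth"
  obtains a where "expansion a x"
  using assms unfolding smooth_torus_def by (elim CollectE exE)

lemma smooth_1 [simp]: "1 \<in> smooth"
  by (rule smoothI[OF expansion_1])

lemma smooth_add [simp]: "x \<in> smooth \<Longrightarrow> y \<in> smooth \<Longrightarrow> x + y \<in> smooth"
  by (elim smoothE) (rule smoothI[OF expansion_add])

lemma smooth_mult [simp]: "x \<in> smooth \<Longrightarrow> y \<in> smooth \<Longrightarrow> x * y \<in> smooth"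
  by (elim smoothE) (rule smoothI[OF expansion_mult])

lemma smooth_scaleC [simp]: "x \<in> smooth \<Longrightarrow> c *\<^sub>C x \<in> smooth"
  by (elim smoothE) (rule smoothI[OF expansion_scaleC])

lemma smooth_deriv2 [simp]: "x \<in> smooth \<Longrightarrow> deriv2 x \<in> smooth"
  by (elim smoothE) (rule smoothI[OF expansion_deriv2])

lemma smooth_scaleR [simp]: "x \<in> smooth \<Longrightarrow> r *\<^sub>R x \<in> smooth"
  using smooth_scaleC[of x "of_real r"] by (simp add: scaleC_of_real)

lemma trace_add:
  assumes "x \<in> smooth" "y \<in> smooth"
  shows "\<tau> (x + y) = \<tau> x + \<tau> y"
proof -
  obtain a b where ab: "expansion a x" "expansion b y"
    using assms by (elim smoothE)
  thus ?thesis
    using torus_trace_eq[OF expansion_add[OF ab]] by (simp add: torus_trace_eq)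
qed

lemma trace_scaleC:
  assumes "x \<in> smooth"
  shows "\<tau> (c *\<^sub>C x) = c * \<tau> x"
proof -
  obtain a where a: "expansion a x"
    using assms by (elim smoothE)
  thus ?thesis
    using torus_trace_eq[OF expansion_scaleC[OF a]] by (simp add: torus_trace_eq)
qed

lemma trace_scaleR:
  assumes "x \<in> smooth"
  shows "\<tau> (r *\<^sub>R x) = of_real r * \<tau> x"
  using trace_scaleC[OF assms, of "of_real r"] by (simp add: scaleC_of_real)

text \<open>
  \<open>\<tau>(xy) = \<Sum>j. a\<^sub>j b\<^sub>-\<^sub>j phase j (-j)\<close>, and \<open>phase j (-j)\<close> is even in \<open>j\<close>; so the substitution of \<open>-j\<close> for \<open>j\<close>
  exchanges the roles of \<open>a\<close> and \<open>b\<close>.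
\<close>
lemma trace_mult_commute:
  assumes "x \<in> smooth" "y \<in> smooth"
  shows "\<tau> (x * y) = \<tau> (y * x)"
proof -
  obtain a b where ab: "expansion a x" "expansion b y"
    using assms by (elim smoothE)
  have "tconv a b 0 = (\<Sum>\<^sub>\<infinity>j. a (- j) * b (- (- j)) * phase (- j) (- (- j)))"
    unfolding tconv_def
    using infsum_reindex_bij_betw[OF bij_uminus, of "\<lambda>j. a j * b (0 - j) * phase j (0 - j)"] by simp
  also have "\<dots> = tconv b a 0"
    unfolding tconv_def by (rule infsum_cong) (simp add: phase_def mult_ac)
  finally show ?thesis
    using ab by (simp add: torus_trace_eq[OF expansion_mult])
qed

text \<open>
  Faithfulness of the trace: the phases of \<open>x\<^sup>*\<close> and of the convolution cancel, and \<open>\<tau>(x\<^sup>* x)\<close> is the sum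
  of the \<open>\<bar>a\<^sub>k\<bar>\<^sup>2\<close>.
\<close>
lemma trace_star_mult_self_eq_0:
  assumes "x \<in> smooth" "\<tau> (star x * x) = 0"
  shows "x = 0"
proof -
  obtain a where a: "expansion a x"
    using assms by (elim smoothE)
  let ?b = "\<lambda>k. cnj (a (- k)) * phase k k"
  have b: "expansion ?b (star x)"
    by (rule expansion_star[OF a])
  have "((\<lambda>j. ?b j * a (0 - j) * phase j (0 - j)) has_sum tconv ?b a 0) UNIV"
    using a b by (intro tconv_has_sum) (simp_all only: expansion_iff)
  moreover have "tconv ?b a 0 = 0"
    using assms(2) torus_trace_eq[OF expansion_mult[OF b a]] by simp
  moreover have "?b j * a (0 - j) * phase j (0 - j) = of_real ((cmod (a (- j)))\<^sup>2)" for j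
  proof -
    have "phase j j * phase j (- j) = 1"
      by (simp add: phase_def cis_mult)
    hence "?b j * a (0 - j) * phase j (0 - j) = a (- j) * cnj (a (- j))"
      by (simp add: mult_ac)
    thus ?thesis by (simp only: complex_norm_square)
  qed
  ultimately have "((\<lambda>j. complex_of_real ((cmod (a (- j)))\<^sup>2)) has_sum of_real 0) UNIV"
    by simp
  hence *: "((\<lambda>j. (cmod (a (- j)))\<^sup>2) has_sum 0) UNIV"
    by (simp only: has_sum_of_real_iff)
  have "a k = 0" for k
    using nonneg_has_sum_le_0D[OF *, of "- k"] by simp
  thus "x = 0"
    by (rule expansion_eqI[OF a expansion_0])
qed

lemma deriv2_add:
  assumes "x \<in> smooth" "y \<in> smooth"
  shows "deriv2 (x + y) = deriv2 x + deriv2 y"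
proof -
  obtain a b where ab: "expansion a x" "expansion b y"
    using assms by (elim smoothE)
  show ?thesis
    by (rule expansion_eqI[OF expansion_deriv2[OF expansion_add[OF ab]]
          expansion_add[OF ab[THEN expansion_deriv2]]]) (simp add: algebra_simps)
qed

lemma deriv2_scaleC:
  assumes "x \<in> smooth"
  shows "deriv2 (c *\<^sub>C x) = c *\<^sub>C deriv2 x"
proof -
  obtain a where a: "expansion a x"
    using assms by (elim smoothE)
  show ?thesis
    by (rule expansion_eqI[OF expansion_deriv2[OF expansion_scaleC[OF a]]
          expansion_scaleC[OF expansion_deriv2[OF a]]]) (simp add: algebra_simps)
qed

lemma deriv2_scaleR:
  assumes "x \<in> smooth"
  shows "deriv2 (r *\<^sub>R x) = r *\<^sub>R deriv2 x"
  using deriv2_scaleC[OF assms, of "of_real r"] by (simp add: scaleC_of_real)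

lemma deriv2_1: "deriv2 1 = 0"
  by (rule expansion_eqI[OF expansion_deriv2[OF expansion_1] expansion_0]) simp

text \<open>
  In the coefficient at \<open>s\<close> the factor \<open>snd s\<close> splits as \<open>snd j + snd (s - j)\<close> in the \<open>j\<close>-th term of the
  convolution.
\<close>
lemma deriv2_mult:
  assumes "x \<in> smooth" "y \<in> smooth"
  shows "deriv2 (x * y) = deriv2 x * y + x * deriv2 y"
proof -
  obtain a b where ab: "expansion a x" "expansion b y"
    using assms by (elim smoothE)
  note d = ab[THEN expansion_deriv2]
  have rd: "rapidly_decreasing a" "rapidly_decreasing b" "rapidly_decreasing (dcoeff a)"
    "rapidly_decreasing (dcoeff b)"
    using ab d by (simp_all only: expansion_iff)
  show ?thesis
  proof (rule expansion_eqI[OF expansion_deriv2[OF expansion_mult[OF ab]]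
        expansion_add[OF expansion_mult[OF d(1) ab(2)] expansion_mult[OF ab(1) d(2)]]])
    fix s :: "int \<times> int"
    let ?c = "2 * of_real pi * \<i> * of_int (snd s) :: complex"
    let ?t = "\<lambda>j. a j * b (s - j) * phase j (s - j)"
    have "((\<lambda>j. dcoeff a j * b (s - j) * phase j (s - j) + a j * dcoeff b (s - j) * phase j (s - j))
        has_sum tconv (dcoeff a) b s + tconv a (dcoeff b) s) UNIV"
      by (intro has_sum_add tconv_has_sum rd)
    moreover have "dcoeff a j * b (s - j) * phase j (s - j) + a j * dcoeff b (s - j) * phase j (s - j)
        = ?c * ?t j" for j
    proof -
      have snd_s: "of_int (snd s) = (of_int (snd j) + of_int (snd (s - j)) :: complex)"
        by simp
      show ?thesis
        unfolding snd_s by (simp only: ring_distribs mult_ac)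
    qed
    ultimately have "((\<lambda>j. ?c * ?t j) has_sum tconv (dcoeff a) b s + tconv a (dcoeff b) s) UNIV"
      by (simp only:)
    moreover have "((\<lambda>j. ?c * ?t j) has_sum ?c * tconv a b s) UNIV"
      by (rule has_sum_cmult_right[OF tconv_has_sum[OF rd(1,2)]])
    ultimately have "tconv (dcoeff a) b s + tconv a (dcoeff b) s = ?c * tconv a b s"
      by (rule has_sum_unique)
    thus "dcoeff (tconv a b) s = tconv (dcoeff a) b s + tconv a (dcoeff b) s"
      by (simp only: mult.assoc)
  qed
qed

lemma deriv2_star:
  assumes "x \<in> smooth"
  shows "deriv2 (star x) = star (deriv2 x)"
proof -
  obtain a where a: "expansion a x"
    using assms by (elim smoothE)
  show ?thesis
    by (rule expansion_eqI[OF expansion_deriv2[OF expansion_star[OF a]]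
          expansion_star[OF expansion_deriv2[OF a]]]) simp
qed

end

section \<open>The Gauss--Bonnet term of a projection\<close>

lemma exp_scaleR_idempotent:
  fixes p :: "'a::{real_normed_algebra_1,banach}"
  assumes "p * p = p"
  shows "exp (s *\<^sub>R p) = 1 + (exp s - 1) *\<^sub>R p"
proof -
  have "p ^ Suc n = p" for n
    by (induction n) (simp_all add: assms)
  hence "(s *\<^sub>R p) ^ n /\<^sub>R fact n = (if n = 0 then 1 - p else 0) + (s ^ n /\<^sub>R fact n) *\<^sub>R p" for n
    by (cases n) (simp_all add: scaleR_power)
  moreover have "(\<lambda>n. (if n = 0 then 1 - p else 0) + (s ^ n /\<^sub>R fact n) *\<^sub>R p)
      sums ((1 - p) + exp s *\<^sub>R p)"
    by (intro sums_add sums_scaleR_left exp_converges) (use sums_single[of 0 "\<lambda>_. 1 - p"] in simp)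
  ultimately have "(\<lambda>n. (s *\<^sub>R p) ^ n /\<^sub>R fact n) sums ((1 - p) + exp s *\<^sub>R p)"
    by simp
  moreover have "(\<lambda>n. (s *\<^sub>R p) ^ n /\<^sub>R fact n) sums exp (s *\<^sub>R p)"
    by (rule exp_converges)
  ultimately have "exp (s *\<^sub>R p) = (1 - p) + exp s *\<^sub>R p"
    by (rule sums_unique2[symmetric])
  thus ?thesis by (simp add: algebra_simps)
qed

lemma infsum_commute:
  fixes f :: "'i \<Rightarrow> 'b::real_normed_algebra"
  assumes "\<And>k. k \<in> A \<Longrightarrow> f k * y = y * f k"
  shows "infsum f A * y = y * infsum f A"
proof (cases "f summable_on A")
  case True
  have "((\<lambda>k. f k * y) has_sum infsum f A * y) A" "((\<lambda>k. y * f k) has_sum y * infsum f A) A"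
    using True by (auto intro: has_sum_cmult_left has_sum_cmult_right)
  moreover have "((\<lambda>k. f k * y) has_sum infsum f A * y) A \<longleftrightarrow>
      ((\<lambda>k. y * f k) has_sum infsum f A * y) A"
    by (rule has_sum_cong) (rule assms)
  ultimately show ?thesis using has_sum_unique by blast
qed (simp add: infsum_not_exists)

context nc_torus_pair
begin

text \<open>
  If \<open>\<partial>\<^sub>2x = 0\<close>, the coefficients of \<open>x\<close> and of \<open>\<partial>\<^sub>1x\<close> live on the line \<open>n = 0\<close>, and the powers of \<open>U\<close> commute.
\<close>
lemma commute_deriv1_if_deriv2_eq_0:
  assumes "x \<in> smooth" "deriv2 x = 0"
  shows "x * torus_deriv1 U V x = torus_deriv1 U V x * x"
proof -
  obtain a where a: "expansion a x"
    using assms by (elim smoothE)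
  have "dcoeff a = (\<lambda>_. 0)"
    using expansion_deriv2[OF a] expansion_0 assms(2) by (metis expansion_unique)
  hence a0: "a k = 0 \<or> snd k = 0" for k
    by (auto dest: fun_cong[of _ _ k])
  have comm: "(c * a k) *\<^sub>C weyl k * (a l *\<^sub>C weyl l) = (a l *\<^sub>C weyl l) * ((c * a k) *\<^sub>C weyl k)"
    for c k l
  proof (cases "a k = 0 \<or> a l = 0")
    case False
    hence "snd k = 0" "snd l = 0" using a0 by blast+
    thus ?thesis
      by (simp add: mult_scaleC_left mult_scaleC_right scaleC_scaleC weyl_mult phase_def
          add.commute[of k l] mult_ac)
  qed auto
  have x: "x = (\<Sum>\<^sub>\<infinity>l. a l *\<^sub>C weyl l)"
    using a unfolding expansion_iff by (metis infsumI)
  have d1: "torus_deriv1 U V x = (\<Sum>\<^sub>\<infinity>k. (2 * of_real pi * \<i> * of_int (fst k) * a k) *\<^sub>C weyl k)"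
    by (simp add: torus_deriv1_def torus_coeff_eq[OF a] weyl_def case_prod_unfold)
  have "x * ((c * a k) *\<^sub>C weyl k) = (c * a k) *\<^sub>C weyl k * x" for c k
    unfolding x by (rule infsum_commute) (rule comm[symmetric])
  thus ?thesis
    unfolding d1 by (intro infsum_commute[symmetric]) simp
qed

text \<open>
  Insert \<open>q = qp + pq\<close> for the second factor of \<open>\<tau>(q q)\<close>, where \<open>q = \<partial>\<^sub>2p\<close>; both resulting terms have trace
  \<open>\<tau>(q\<^sup>2p)\<close>.
\<close>
lemma trace_deriv2_square_idempotent:
  assumes p: "p \<in> smooth" "p * p = p"
  shows "2 * \<tau> (deriv2 p * deriv2 p * p) = \<tau> (deriv2 p * deriv2 p)"
proof -
  let ?q = "deriv2 p"
  have "?q = ?q * p + p * ?q"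
    using deriv2_mult[OF p(1) p(1)] p(2) by simp
  hence "\<tau> (?q * ?q) = \<tau> (?q * (?q * p) + (?q * p) * ?q)"
    by (metis distrib_left mult.assoc)
  also have "\<dots> = 2 * \<tau> (?q * (?q * p))"
    using p(1) trace_mult_commute[of "?q * p" ?q] by (simp add: trace_add)
  finally show ?thesis by (simp add: mult.assoc)
qed

lemma gauss_bonnet_term_idempotent:
  fixes t :: real
  assumes p: "p \<in> smooth" "p * p = p"
  defines "r \<equiv> exp (t / 2)"
  shows "gauss_bonnet_term U V p t =
    of_real ((r - 1) ^ 3 * (r\<^sup>2 - 1) / (4 * r\<^sup>2)) * \<tau> (deriv2 p * deriv2 p)"
proof -
  let ?q = "deriv2 p"
  define T where "T = \<tau> (?q * ?q)"
  have T: "\<tau> (?q * ?q * p) = T / 2"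
    using trace_deriv2_square_idempotent[OF p] by (simp add: T_def mult.commute)
  have r: "r > 0" "exp (- (t / 2)) = 1 / r" "exp t = r\<^sup>2" "exp (- t) = 1 / r\<^sup>2"
    by (simp_all add: r_def exp_minus field_simps flip: exp_of_nat_mult exp_add)
  have d_exp: "deriv2 (exp (s *\<^sub>R p)) = (exp s - 1) *\<^sub>R ?q" for s
    unfolding exp_scaleR_idempotent[OF p(2)]
    using p(1) by (simp add: deriv2_add deriv2_scaleR deriv2_1)
  have "deriv2 (exp (- (t / 2) *\<^sub>R p)) * deriv2 (exp (t *\<^sub>R p)) +
      deriv2 (exp ((t / 2) *\<^sub>R p)) * deriv2 (exp (t *\<^sub>R p)) * exp (- t *\<^sub>R p) =
      ((1 / r - 1) * (r\<^sup>2 - 1) + (r - 1) * (r\<^sup>2 - 1)) *\<^sub>R (?q * ?q) +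
      ((r - 1) * (r\<^sup>2 - 1) * (1 / r\<^sup>2 - 1)) *\<^sub>R (?q * ?q * p)"
    unfolding d_exp unfolding exp_scaleR_idempotent[OF p(2)] r r_def[symmetric]
    by (simp add: distrib_left scaleR_add_left mult_ac)
  hence "gauss_bonnet_term U V p t =
      1 / 2 * (of_real ((1 / r - 1) * (r\<^sup>2 - 1) + (r - 1) * (r\<^sup>2 - 1)) * T +
        of_real ((r - 1) * (r\<^sup>2 - 1) * (1 / r\<^sup>2 - 1)) * (T / 2))"
    unfolding gauss_bonnet_term_def using p(1)
    by (simp only: trace_add trace_scaleR smooth_mult smooth_deriv2 smooth_scaleR T T_def)
  also have "\<dots> = of_real (1 / 2 * ((1 / r - 1) * (r\<^sup>2 - 1) + (r - 1) * (r\<^sup>2 - 1)) +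
      1 / 4 * ((r - 1) * (r\<^sup>2 - 1) * (1 / r\<^sup>2 - 1))) * T"
    by (simp add: algebra_simps)
  also have "1 / 2 * ((1 / r - 1) * (r\<^sup>2 - 1) + (r - 1) * (r\<^sup>2 - 1)) +
      1 / 4 * ((r - 1) * (r\<^sup>2 - 1) * (1 / r\<^sup>2 - 1)) = (r - 1) ^ 3 * (r\<^sup>2 - 1) / (4 * r\<^sup>2)"
    using r(1) by (simp add: field_simps power2_eq_square power3_eq_cube)
  finally show ?thesis by (simp only: T_def)
qed

end

theorem proposition5p3:
  fixes \<theta> :: real and U V p :: "'a::cstar_algebra"
  assumes "nc_torus \<theta> U V"
    and "p \<in> smooth_torus U V"
    and "star p = p" and "p\<^sup>2 = p"
    and "p * torus_deriv1 U V p \<noteq> torus_deriv1 U V p * p \<or>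
         p * torus_deriv2 U V p \<noteq> torus_deriv2 U V p * p"
  shows "\<exists>\<epsilon>::real. \<exists>\<delta>>0. \<forall>t. \<bar>t - \<epsilon>\<bar> < \<delta> \<longrightarrow> gauss_bonnet_term U V p t \<noteq> 0"
proof -
  interpret nc_torus_pair \<theta> U V
    by unfold_locales (fact assms(1))
  have p: "p \<in> smooth" "p * p = p"
    using assms(2,4) by (simp_all add: power2_eq_square)
  have "deriv2 p \<noteq> 0"
    using assms(5) commute_deriv1_if_deriv2_eq_0[OF p(1)] by auto
  moreover have "star (deriv2 p) = deriv2 p"
    using deriv2_star[OF p(1)] assms(3) by simp
  ultimately have trace: "\<tau> (deriv2 p * deriv2 p) \<noteq> 0"
    using trace_star_mult_self_eq_0[of "deriv2 p"] p(1) by auto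
  have "gauss_bonnet_term U V p t \<noteq> 0" if "\<bar>t - 1\<bar> < 1" for t
  proof -
    have r: "exp (t / 2) > 1"
      using that by simp
    hence "(exp (t / 2))\<^sup>2 > 1"
      by (rule one_less_power) simp
    with r have "exp (t / 2) - 1 \<noteq> 0" "(exp (t / 2))\<^sup>2 - 1 \<noteq> 0"
      by linarith+
    hence "(exp (t / 2) - 1) ^ 3 * ((exp (t / 2))\<^sup>2 - 1) / (4 * (exp (t / 2))\<^sup>2) \<noteq> 0"
      by simp
    with trace show ?thesis
      unfolding gauss_bonnet_term_idempotent[OF p] mult_eq_0_iff of_real_eq_0_iff by blast
  qed
  thus ?thesis
    by (intro exI[of _ 1] conjI) auto
qed

end
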